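(* Let $L>0$, $\Omega=(-L,L)$, $\Gamma=\{-L,L\}$, and let $(\Gamma_D,\Gamma_N)$ be one of $(\emptyset,\Gamma)$, $(\{L\},\{-L\})$, $(\{-L\},\{L\})$. Let $\mathcal{H}=\{v\in H^1(\Omega):v=0\text{ on }\Gamma_D\}$ and $\omega\ge\omega_0>0$. Let $a,c\in C^1_{\mathrm{pw}}[-L,L]$ satisfy $a_{\min}\le a\le a_{\max}$, $c_{\min}\le c\le c_{\max}$ with $a_{\min},c_{\min}>0$, and let $-L=z_0<\dots<z_N=L$ be a partition such that on each $\tau_j=(z_{j-1},z_j)$, $a,c$ are $C^1$ on $[z_{j-1},z_j]$ and each of $a',c'$ is either $>0$ throughout $\tau_j$ or $\le 0$ throughout $\tau_j$. Let $f\in L^2(\Omega)$, $g_x\in\mathbb{C}$ ($x\in\Gamma_N$), and let $u\in\mathcal{H}$ satisfy $$\int_{-L}^L\Big(au'\bar v'-\big(\tfrac{\omega}{c}\big)^2u\bar v\Big)-\mathrm{i}\sum_{x\in\Gamma_N}\omega\frac{\sqrt{a(x)}}{c(x)}u(x)\bar v(x)=\int_{-L}^Lf\bar v+\sum_{x\in\Gamma_N}g_x\bar v(x)\quad\forall v\in\mathcal{H}.$$ Let $q$ be real-valued with $q|_{\tau_j}\in C^1(\overline{\tau_j})$ for each $j$, $q=0$ on $\Gamma_D$, and suppose moreover that for each $j=1,\dots,N$ $$\partial_{\mathrm{pw}}\Big(\frac qa\Big)(x)\ge\frac1{a(x)},\qquad \partial_{\mathrm{pw}}\Big(\frac q{c^2}\Big)(x)\ge\frac1{c^2(x)},\qquad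 x\in\tau_j,$$ and that $[q/a]_{z_j}\le0$ and $[q/c^2]_{z_j}\le0$ for $j=1,\dots,N-1$. Then $$\|u\|_{\mathcal{H},a,c}\le C^{\mathrm{I}}_{\mathrm{stab}}Q\|f\|+C^{\mathrm{II}}_{\mathrm{stab}}\sqrt Q\,\|g\|_{\Gamma_N},$$ where $Q=\|q\|_{L^\infty(-L,L)}$, $C^{\mathrm{I}}_{\mathrm{stab}}=\frac{2}{\sqrt{a_{\min}}}\big(1+3\frac{c_{\max}}{c_{\min}}\big)$ and $C^{\mathrm{II}}_{\mathrm{stab}}=\frac2{\sqrt{a_{\min}}}\sqrt{\frac32\frac{c_{\max}}{c_{\min}}+1}$.
   Context: $C^1_{\mathrm{pw}}[-L,L]$ is the set of $g:[-L,L]\to\mathbb{R}$ for which there is a finite partition $-L=z_0<\dots<z_N=L$ with $g\in C^1[z_{j-1},z_j]$ for each $j$ and, on each $(z_{j-1},z_j)$, either $g'>0$ throughout or $g'\le0$ throughout. For the partition, $g^{\pm}(z_j)$ are the right/left one-sided limits, $[g]_{z_j}=g^-(z_j)-g^+(z_j)$ for $1\le j\le N-1$, and $\partial_{\mathrm{pw}}g(x)=g'(x)$ for $x\in(z_{j-1},z_j)$. $\|\cdot\|$ is the $L^2(\Omega)$ norm, $\|v\|^2_{\mathcal{H},a,c}=\|\sqrt a v'\|^2+\|(\omega/c)v\|^2$, and $\|g\|^2_{\Gamma_N}=\sum_{x\in\Gamma_N}|g_x|^2$. *)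

theory Defs
  imports "HOL-Analysis.Analysis" "HOL-Probability.Essential_Supremum"
begin

definition L2_on :: "real \<Rightarrow> (real \<Rightarrow> complex) \<Rightarrow> bool" where
  "L2_on L f \<longleftrightarrow> f measurable_on {-L..L} \<and> (\<lambda>x. (cmod (f x))\<^sup>2) integrable_on {-L..L}"

definition L2_norm :: "real \<Rightarrow> (real \<Rightarrow> complex) \<Rightarrow> real" where
  "L2_norm L f = sqrt (integral {-L..L} (\<lambda>x. (cmod (f x))\<^sup>2))"

text \<open>H^1(Omega) in one dimension: v (its continuous representative) is an
  indefinite integral of an L^2 function dv, which is then the weak derivative v'.\<close>
definition H1_with_deriv :: "real \<Rightarrow> (real \<Rightarrow> complex) \<Rightarrow> (real \<Rightarrow> complex) \<Rightarrow> bool" where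
  "H1_with_deriv L v dv \<longleftrightarrow> L2_on L v \<and> L2_on L dv \<and>
     (\<forall>x\<in>{-L..L}. v x = v (-L) + integral {-L..x} dv)"

definition C1_piece :: "real \<Rightarrow> real \<Rightarrow> (real \<Rightarrow> real) \<Rightarrow> (real \<Rightarrow> real) \<Rightarrow> (real \<Rightarrow> real) \<Rightarrow> bool" where
  "C1_piece s t g G G' \<longleftrightarrow> s < t \<and> continuous_on {s..t} G' \<and>
     (\<forall>x\<in>{s..t}. (G has_real_derivative G' x) (at x within {s..t})) \<and>
     (\<forall>x\<in>{s<..<t}. G x = g x)"

definition is_partition :: "real \<Rightarrow> (nat \<Rightarrow> real) \<Rightarrow> nat \<Rightarrow> bool" where
  "is_partition L z N \<longleftrightarrow> N \<ge> 1 \<and> z 0 = -L \<and> z N = L \<and> (\<forall>j<N. z j < z (Suc j))"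

definition pw_C1 :: "real \<Rightarrow> (nat \<Rightarrow> real) \<Rightarrow> nat \<Rightarrow> (real \<Rightarrow> real) \<Rightarrow> bool" where
  "pw_C1 L z N g \<longleftrightarrow> (\<forall>j\<in>{1..N}. \<exists>G G'. C1_piece (z (j-1)) (z j) g G G' \<and>
      (j = 1 \<longrightarrow> G (-L) = g (-L)) \<and> (j = N \<longrightarrow> G L = g L))"

definition pw_C1_mono :: "real \<Rightarrow> (nat \<Rightarrow> real) \<Rightarrow> nat \<Rightarrow> (real \<Rightarrow> real) \<Rightarrow> bool" where
  "pw_C1_mono L z N g \<longleftrightarrow> (\<forall>j\<in>{1..N}. \<exists>G G'. C1_piece (z (j-1)) (z j) g G G' \<and>
      (j = 1 \<longrightarrow> G (-L) = g (-L)) \<and> (j = N \<longrightarrow> G L = g L) \<and>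
      ((\<forall>x\<in>{z (j-1)<..<z j}. G' x > 0) \<or> (\<forall>x\<in>{z (j-1)<..<z j}. G' x \<le> 0)))"

definition jump :: "(real \<Rightarrow> real) \<Rightarrow> real \<Rightarrow> real" where
  "jump g x = Lim (at_left x) g - Lim (at_right x) g"

definition Linf_norm :: "real \<Rightarrow> (real \<Rightarrow> real) \<Rightarrow> real" where
  "Linf_norm L q = real_of_ereal (esssup (restrict_space lebesgue {-L<..<L}) (\<lambda>x. ereal \<bar>q x\<bar>))"

end

theory Submission
  imports Defs
begin

text \<open>The flux $a u'$ agrees almost everywhere with a function $w$ that is absolutely continuous on
  all of $[-L,L]$ and satisfies $w' = -((\omega/c)^2 u + f)$; in particular $w$ and $u$ do not jump at the
  points of the partition. On each piece the function
  $\Phi = (q/a)|w|^2 + \omega^2 (q/c^2) |u|^2$ is absolutely continuous, the terms with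
  $\mathrm{Re}(u \bar u')$ cancel in its derivative, and the hypotheses on $q$ give
  $\Phi' \ge a|u'|^2 + (\omega/c)^2|u|^2 - 2 q\,\mathrm{Re}(f \bar u')$. The jump conditions make $\Phi$
  increase across the partition points, so summation over the pieces bounds the energy by
  $2Q\|f\|\|u'\|$ plus boundary values of $\Phi$. These vanish on $\Gamma_D$; on $\Gamma_N$ the impedance
  condition for $w$ reduces them to $|g|^2$ and $|u|^2$, and $|u|^2$ on $\Gamma_N$ is controlled by the
  imaginary part of the weak formulation tested with $u$ itself.\<close>

text \<open>Formally this is the Rellich-Morawetz argument of testing with \<open>2 q u'\<close>.
  That function need not be admissible: \<open>q\<close> may jump at partition points and
  \<open>u'\<close> is only square integrable. The identity is therefore obtained by differentiating
  \<Phi>, whose factors are absolutely continuous on each piece, and this is why a product rule for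
  indefinite integrals comes first. The values of \<open>a\<close>, \<open>c\<close>,
  \<open>q\<close> at interior partition points carry no information on the one-sided limits. On
  each closed piece C1 representatives replace them, and \<Phi> gets one version per piece.
  Constants: let \<open>M\<close> be the energy norm, \<open>F\<close> and \<open>G\<close> the data
  norms, \<open>s = sqrt amin\<close>, \<open>r = cmax / cmin\<close>. The bounds combine to the
  quadratic inequality \<open>M^2 <= (2/s) (1 + 3 r) Q F M + ((3 r + 2) / s^2) Q G^2\<close>. The 3
  arises as 1 + 2 when the impedance condition is squared. No frequency survives: exchanging
  boundary energy for the impedance term costs a factor \<omega>, and the bound of the norm of
  \<open>u\<close> by \<open>(cmax / \<omega>) M\<close> returns it.\<close>

section \<open>Integration by parts for absolutely continuous functions\<close>

text \<open>Fubini's theorem is applied to \<open>lebesgue\<close>, the completion of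
  \<open>lborel\<close>. A countable cover by sets of finite measure survives completion, since
  measurable sets keep their measure.\<close>

lemma sigma_finite_completion:
  assumes "sigma_finite_measure M"
  shows "sigma_finite_measure (completion M)"
proof -
  interpret sigma_finite_measure M by fact
  obtain A where A: "countable A" "A \<subseteq> sets M" "\<Union>A = space M" "\<forall>a\<in>A. emeasure M a \<noteq> \<infinity>"
    using sigma_finite_countable by blast
  show ?thesis
  proof
    show "\<exists>A. countable A \<and> A \<subseteq> sets (completion M) \<and> \<Union>A = space (completion M) \<and>
        (\<forall>a\<in>A. emeasure (completion M) a \<noteq> \<infinity>)"
      using A by (intro exI[of _ A]) (auto simp: subset_iff)
  qed
qed

text \<open>Both sides integrate \<open>f x * g y\<close> over the half plane
  \<open>y \<le> x\<close>; the integrand is dominated by a product of two integrable functions of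
  one variable.\<close>

lemma lebesgue_parts_Fubini:
  fixes f g :: "real \<Rightarrow> complex"
  assumes f: "integrable lebesgue f" and g: "integrable lebesgue g"
  shows "(LINT x|lebesgue. f x * (LINT y|lebesgue. indicator {..x} y * g y))
       = (LINT y|lebesgue. g y * (LINT x|lebesgue. indicator {y..} x * f x))"
proof -
  interpret S: sigma_finite_measure "lebesgue :: real measure"
    using sigma_finite_completion sigma_finite_lborel by blast
  interpret P: pair_sigma_finite "lebesgue :: real measure" "lebesgue :: real measure" ..
  have [measurable]: "f \<in> borel_measurable lebesgue" "g \<in> borel_measurable lebesgue"
    using f g by auto
  have i1: "integrable (lebesgue \<Otimes>\<^sub>M lebesgue) (\<lambda>(x, y). f x * g y)"
  proof (rule P.Fubini_integrable)
    show "(\<lambda>(x, y). f x * g y) \<in> borel_measurable (lebesgue \<Otimes>\<^sub>M lebesgue)"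
      by measurable
    show "integrable lebesgue (\<lambda>x. LINT y|lebesgue. norm (case (x, y) of (x, y) \<Rightarrow> f x * g y))"
      using f by (simp add: norm_mult)
    show "AE x in lebesgue. integrable lebesgue (\<lambda>y. case (x, y) of (x, y) \<Rightarrow> f x * g y)"
      using g by simp
  qed
  \<comment> \<open>The half plane is obtained by comparing the two coordinate projections, each
    composed with the identity from \<open>lebesgue\<close> to the Borel sets.\<close>
  have m: "(\<lambda>p. indicator {p :: real \<times> real. snd p \<le> fst p} p :: complex) \<in> borel_measurable (lebesgue \<Otimes>\<^sub>M lebesgue)"
  proof -
    have id: "(\<lambda>x. x) \<in> borel_measurable (lebesgue :: real measure)"
      by (simp add: measurable_completion)
    have "fst \<in> borel_measurable (lebesgue \<Otimes>\<^sub>M lebesgue :: (real \<times> real) measure)"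
      "snd \<in> borel_measurable (lebesgue \<Otimes>\<^sub>M lebesgue :: (real \<times> real) measure)"
      using measurable_compose[OF measurable_fst id] measurable_compose[OF measurable_snd id] by auto
    then have "{p \<in> space (lebesgue \<Otimes>\<^sub>M lebesgue). snd p \<le> (fst p :: real)} \<in> sets (lebesgue \<Otimes>\<^sub>M lebesgue)"
      by (intro borel_measurable_le)
    then show ?thesis
      by (intro borel_measurable_indicator) (simp add: space_pair_measure)
  qed
  have i2: "integrable (lebesgue \<Otimes>\<^sub>M lebesgue) (\<lambda>(x, y). f x * (indicator {..x} y * g y))"
  proof (rule Bochner_Integration.integrable_bound[OF i1])
    have "(\<lambda>(x, y). f x * (indicator {..x} y * g y)) =
       (\<lambda>p. f (fst p) * (indicator {p. snd p \<le> fst p} p * g (snd p)))"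
      by (auto simp: indicator_def)
    with m show "(\<lambda>(x, y). f x * (indicator {..x} y * g y)) \<in> borel_measurable (lebesgue \<Otimes>\<^sub>M lebesgue)"
      by simp
  qed (auto simp: norm_mult indicator_def)
  have "(LINT x|lebesgue. f x * (LINT y|lebesgue. indicator {..x} y * g y))
     = (LINT x|lebesgue. LINT y|lebesgue. f x * (indicator {..x} y * g y))"
    by simp
  also have "\<dots> = (LINT y|lebesgue. LINT x|lebesgue. f x * (indicator {..x} y * g y))"
    using P.Fubini_integral[OF i2] by simp
  also have "\<dots> = (LINT y|lebesgue. LINT x|lebesgue. g y * (indicator {y..} x * f x))"
    by (intro Bochner_Integration.integral_cong) (auto simp: indicator_def)
  finally show ?thesis by simp
qed

text \<open>As a rewrite rule the equation below loops (its instance at the left end point rewrites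
  \<open>F s\<close> to a term containing \<open>F s\<close>), so an unfolded
  assumption \<open>AC_on s t F f\<close> must be kept from the simplifier.\<close>

definition AC_on :: "real \<Rightarrow> real \<Rightarrow> (real \<Rightarrow> complex) \<Rightarrow> (real \<Rightarrow> complex) \<Rightarrow> bool" where
  "AC_on s t F f \<longleftrightarrow> f absolutely_integrable_on {s..t} \<and>
     (\<forall>x\<in>{s..t}. F x = F s + integral {s..x} f)"

lemma AC_on_absolutely_integrable: "AC_on s t F f \<Longrightarrow> f absolutely_integrable_on {s..t}"
  by (simp add: AC_on_def)

lemma AC_on_integrable: "AC_on s t F f \<Longrightarrow> f integrable_on {s..t}"
  by (intro set_lebesgue_integral_eq_integral(1) AC_on_absolutely_integrable)

lemma AC_on_eq: "AC_on s t F f \<Longrightarrow> x \<in> {s..t} \<Longrightarrow> F x = F s + integral {s..x} f"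
  unfolding AC_on_def by blast

lemma AC_on_continuous:
  assumes "AC_on s t F f"
  shows "continuous_on {s..t} F"
proof (rule continuous_on_eq)
  show "continuous_on {s..t} (\<lambda>x. F s + integral {s..x} f)"
    by (intro continuous_on_add continuous_on_const indefinite_integral_continuous_1 AC_on_integrable[OF assms])
  show "F s + integral {s..x} f = F x" if "x \<in> {s..t}" for x
    using AC_on_eq[OF assms that] by (rule sym)
qed

lemma AC_on_diff:
  assumes F: "AC_on s t F f" and xy: "s \<le> x" "x \<le> y" "y \<le> t"
  shows "integral {x..y} f = F y - F x"
proof -
  have "f integrable_on {s..y}"
    using AC_on_integrable[OF F] by (rule integrable_on_subinterval) (use xy in auto)
  note combine = Henstock_Kurzweil_Integration.integral_combine[OF xy(1,2) this]
  have "F x = F s + integral {s..x} f" "F y = F s + integral {s..y} f"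
    using xy by (intro AC_on_eq[OF F]; simp)+
  then show ?thesis using combine by (simp only: algebra_simps)
qed

lemma AC_on_subinterval:
  assumes "AC_on s t F f" "s \<le> s'" "t' \<le> t"
  shows "AC_on s' t' F f"
  unfolding AC_on_def
proof (intro conjI ballI)
  have "{s'..t'} \<subseteq> {s..t}" using assms by auto
  then show "f absolutely_integrable_on {s'..t'}"
    using assms(1) absolutely_integrable_on_subinterval unfolding AC_on_def by blast
  show "F x = F s' + integral {s'..x} f" if "x \<in> {s'..t'}" for x
    using that AC_on_diff[OF assms(1), of s' x] assms by auto
qed

lemma continuous_mult_absolutely_integrable:
  fixes f g :: "real \<Rightarrow> complex"
  assumes "continuous_on {s..t} f" "g absolutely_integrable_on {s..t}"
  shows "(\<lambda>x. f x * g x) absolutely_integrable_on {s..t}"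
  by (rule absolutely_integrable_bounded_measurable_product)
     (use assms in \<open>auto simp: bilinear_times intro!: continuous_imp_measurable_on_sets_lebesgue
       compact_imp_bounded compact_continuous_image\<close>)

text \<open>The library's integration by parts needs classical derivatives off a countable set; here it
  follows from Fubini's theorem on the triangle \<open>y \<le> x\<close>.\<close>

lemma AC_on_mult_endpoint:
  assumes F: "AC_on s t F f" and G: "AC_on s t G g" and st: "s \<le> t"
  shows "integral {s..t} (\<lambda>x. f x * G x + F x * g x) = F t * G t - F s * G s"
proof -
  define f' where "f' = (\<lambda>x. indicator {s..t} x * f x)"
  define g' where "g' = (\<lambda>x. indicator {s..t} x * g x)"
  have fi: "f absolutely_integrable_on {s..t}" and gi: "g absolutely_integrable_on {s..t}"
    using F G AC_on_absolutely_integrable by blast+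
  have scale: "indicator A x *\<^sub>R h x = indicator A x * (h x :: complex)" for A x and h :: "real \<Rightarrow> complex"
    by (auto simp: indicator_def)
  have f': "integrable lebesgue f'" and g': "integrable lebesgue g'"
    using fi gi by (auto simp: set_integrable_def f'_def g'_def scale)
  have G1: "(LINT y|lebesgue. indicator {..x} y * g' y) = G x - G s" if "x \<in> {s..t}" for x
  proof -
    have "(LINT y|lebesgue. indicator {..x} y * g' y) = set_lebesgue_integral lebesgue {s..x} g"
      unfolding set_lebesgue_integral_def g'_def
      by (intro Bochner_Integration.integral_cong) (use that in \<open>auto simp: indicator_def\<close>)
    also have "\<dots> = integral {s..x} g"
      using AC_on_subinterval[OF G, of s x] that
      by (intro set_lebesgue_integral_eq_integral AC_on_absolutely_integrable) auto
    also have "\<dots> = G x - G s"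
      using that by (intro AC_on_diff[OF G]) auto
    finally show ?thesis .
  qed
  have F1: "(LINT x|lebesgue. indicator {y..} x * f' x) = F t - F y" if "y \<in> {s..t}" for y
  proof -
    have "(LINT x|lebesgue. indicator {y..} x * f' x) = set_lebesgue_integral lebesgue {y..t} f"
      unfolding set_lebesgue_integral_def f'_def
      by (intro Bochner_Integration.integral_cong) (use that in \<open>auto simp: indicator_def\<close>)
    also have "\<dots> = integral {y..t} f"
      using AC_on_subinterval[OF F, of y t] that
      by (intro set_lebesgue_integral_eq_integral AC_on_absolutely_integrable) auto
    also have "\<dots> = F t - F y"
      using that by (intro AC_on_diff[OF F]) auto
    finally show ?thesis .
  qed
  have cF: "continuous_on {s..t} F" and cG: "continuous_on {s..t} G"
    using F G AC_on_continuous by auto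
  \<comment> \<open>Normalising \<open>G\<close> to vanish at \<open>s\<close> and \<open>F\<close>
    at \<open>t\<close> turns both into the inner integrals of the half-plane formula; the constants
    \<open>G s\<close> and \<open>F t\<close> are put back after \<open>eq\<close>.\<close>
  have i1: "(\<lambda>x. (G x - G s) * f x) absolutely_integrable_on {s..t}"
    by (intro continuous_mult_absolutely_integrable continuous_intros cG fi)
  have i2: "(\<lambda>x. (F t - F x) * g x) absolutely_integrable_on {s..t}"
    by (intro continuous_mult_absolutely_integrable continuous_intros cF gi)
  have "integral {s..t} (\<lambda>x. (G x - G s) * f x) =
      (LINT x|lebesgue. f' x * (LINT y|lebesgue. indicator {..x} y * g' y))"
    unfolding set_lebesgue_integral_eq_integral(2)[OF i1, symmetric] set_lebesgue_integral_def
    by (intro Bochner_Integration.integral_cong) (auto simp: f'_def G1 split: split_indicator)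
  also have "\<dots> = (LINT y|lebesgue. g' y * (LINT x|lebesgue. indicator {y..} x * f' x))"
    by (rule lebesgue_parts_Fubini[OF f' g'])
  also have "\<dots> = integral {s..t} (\<lambda>x. (F t - F x) * g x)"
    unfolding set_lebesgue_integral_eq_integral(2)[OF i2, symmetric] set_lebesgue_integral_def
    by (intro Bochner_Integration.integral_cong) (auto simp: g'_def F1 split: split_indicator)
  finally have eq: "integral {s..t} (\<lambda>x. (G x - G s) * f x) = integral {s..t} (\<lambda>x. (F t - F x) * g x)" .
  have j1: "(\<lambda>x. (G x - G s) * f x) integrable_on {s..t}" and j2: "(\<lambda>x. (F t - F x) * g x) integrable_on {s..t}"
    using i1 i2 set_lebesgue_integral_eq_integral(1) by auto
  have j3: "f integrable_on {s..t}" and j4: "g integrable_on {s..t}"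
    using F G AC_on_integrable by auto
  have "integral {s..t} (\<lambda>x. f x * G x + F x * g x) =
    integral {s..t} (\<lambda>x. ((G x - G s) * f x - (F t - F x) * g x) + (G s * f x + F t * g x))"
    by (intro integral_cong) (simp add: algebra_simps)
  also have "\<dots> = G s * integral {s..t} f + F t * integral {s..t} g"
  proof (rule integral_unique)
    have "((\<lambda>x. (G x - G s) * f x - (F t - F x) * g x + (G s * f x + F t * g x)) has_integral
      (integral {s..t} (\<lambda>x. (F t - F x) * g x) - integral {s..t} (\<lambda>x. (F t - F x) * g x)
        + (G s * integral {s..t} f + F t * integral {s..t} g))) {s..t}"
      using integrable_integral[OF j1] integrable_integral[OF j2] integrable_integral[OF j3] integrable_integral[OF j4]
      unfolding eq by (intro has_integral_add has_integral_diff has_integral_mult_right)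
    then show "((\<lambda>x. (G x - G s) * f x - (F t - F x) * g x + (G s * f x + F t * g x)) has_integral
      (G s * integral {s..t} f + F t * integral {s..t} g)) {s..t}"
      by (simp only: diff_self add_0)
  qed
  also have "integral {s..t} f = F t - F s" by (rule AC_on_diff[OF F]) (use st in auto)
  also have "integral {s..t} g = G t - G s" by (rule AC_on_diff[OF G]) (use st in auto)
  finally show ?thesis by (simp add: algebra_simps)
qed

lemma AC_on_mult:
  assumes F: "AC_on s t F f" and G: "AC_on s t G g"
  shows "AC_on s t (\<lambda>x. F x * G x) (\<lambda>x. f x * G x + F x * g x)"
  unfolding AC_on_def
proof (intro conjI ballI)
  have "(\<lambda>x. G x * f x + F x * g x) absolutely_integrable_on {s..t}"
    using F G AC_on_continuous
    by (intro set_integral_add continuous_mult_absolutely_integrable)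
       (auto intro: AC_on_absolutely_integrable)
  then show "(\<lambda>x. f x * G x + F x * g x) absolutely_integrable_on {s..t}"
    by (simp add: mult.commute)
  show "F x * G x = F s * G s + integral {s..x} (\<lambda>x. f x * G x + F x * g x)" if "x \<in> {s..t}" for x
    using AC_on_mult_endpoint[OF AC_on_subinterval[OF F, of s x] AC_on_subinterval[OF G, of s x]] that by simp
qed

lemma AC_on_add:
  assumes F: "AC_on s t F f" and G: "AC_on s t G g"
  shows "AC_on s t (\<lambda>x. F x + G x) (\<lambda>x. f x + g x)"
  unfolding AC_on_def
proof (intro conjI ballI)
  show "(\<lambda>x. f x + g x) absolutely_integrable_on {s..t}"
    using F G by (intro set_integral_add AC_on_absolutely_integrable)
  show "F x + G x = F s + G s + integral {s..x} (\<lambda>x. f x + g x)" if "x \<in> {s..t}" for x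
    using AC_on_diff[OF F, of s x] AC_on_diff[OF G, of s x] that
      AC_on_integrable[OF AC_on_subinterval[OF F, of s x]] AC_on_integrable[OF AC_on_subinterval[OF G, of s x]]
    by (simp add: Henstock_Kurzweil_Integration.integral_add)
qed

lemma AC_on_cnj:
  assumes F: "AC_on s t F f"
  shows "AC_on s t (\<lambda>x. cnj (F x)) (\<lambda>x. cnj (f x))"
  unfolding AC_on_def
proof (intro conjI ballI)
  have "cnj \<circ> f absolutely_integrable_on {s..t}"
    by (rule absolutely_integrable_linear) (auto intro: AC_on_absolutely_integrable[OF F] bounded_linear_cnj)
  then show "(\<lambda>x. cnj (f x)) absolutely_integrable_on {s..t}" by (simp add: o_def)
  show "cnj (F x) = cnj (F s) + integral {s..x} (\<lambda>x. cnj (f x))" if "x \<in> {s..t}" for x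
    using AC_on_eq[OF F that] by (metis complex_cnj_add integral_cnj)
qed

lemma AC_on_of_real:
  assumes cont: "continuous_on {s..t} p"
    and der: "\<And>x. x \<in> {s..t} \<Longrightarrow> (P has_real_derivative p x) (at x within {s..t})"
  shows "AC_on s t (\<lambda>x. of_real (P x)) (\<lambda>x. of_real (p x))"
  unfolding AC_on_def
proof (intro conjI ballI)
  show "(\<lambda>x. complex_of_real (p x)) absolutely_integrable_on {s..t}"
    by (intro absolutely_integrable_continuous_real continuous_intros cont)
  fix x assume x: "x \<in> {s..t}"
  have "(p has_integral P x - P s) {s..x}"
    by (rule fundamental_theorem_of_calculus)
       (use x in \<open>auto simp flip: has_real_derivative_iff_has_vector_derivative
          intro!: DERIV_subset[OF der]\<close>)
  then have "((\<lambda>x. complex_of_real (p x)) has_integral of_real (P x - P s)) {s..x}"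
    by (rule has_integral_of_real)
  then show "complex_of_real (P x) = of_real (P s) + integral {s..x} (\<lambda>x. of_real (p x))"
    by (simp add: integral_unique)
qed

lemma AC_on_indefinite_integral:
  "f absolutely_integrable_on {s..t} \<Longrightarrow> AC_on s t (\<lambda>x. C + integral {s..x} f) f"
  by (auto simp: AC_on_def)

section \<open>Square-integrable functions and the flux\<close>

lemma L2_on_iff:
  "L2_on L f \<longleftrightarrow> f \<in> borel_measurable (lebesgue_on {-L..L}) \<and> (\<lambda>x. (cmod (f x))\<^sup>2) integrable_on {-L..L}"
  by (simp add: L2_on_def measurable_on_iff_borel_measurable)

lemma L2_on_continuous:
  assumes "continuous_on {-L..L} f"
  shows "L2_on L f"
  unfolding L2_on_iff
  by (intro conjI continuous_imp_measurable_on_sets_lebesgue integrable_continuous_real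
      continuous_on_power continuous_on_norm assms) simp

lemma L2_on_bounded_mult:
  assumes b: "b \<in> borel_measurable (lebesgue_on {-L..L})" "\<And>x. x \<in> {-L..L} \<Longrightarrow> cmod (b x) \<le> B"
    and f: "L2_on L f"
  shows "L2_on L (\<lambda>x. b x * f x)"
proof -
  have [measurable]: "b \<in> borel_measurable (lebesgue_on {-L..L})" "f \<in> borel_measurable (lebesgue_on {-L..L})"
    using b f by (auto simp: L2_on_iff)
  have "(\<lambda>x. (cmod (b x * f x))\<^sup>2) absolutely_integrable_on {-L..L}"
  proof (rule measurable_bounded_by_integrable_imp_absolutely_integrable)
    show "(\<lambda>x. B\<^sup>2 * (cmod (f x))\<^sup>2) integrable_on {-L..L}"
      using f by (auto simp: L2_on_iff intro: integrable_on_mult_right)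
    show "norm ((cmod (b x * f x))\<^sup>2) \<le> B\<^sup>2 * (cmod (f x))\<^sup>2" if "x \<in> {-L..L}" for x
      using b(2)[OF that] by (auto simp: norm_mult power_mult_distrib intro!: mult_right_mono power_mono)
  qed simp_all
  then show ?thesis
    unfolding L2_on_iff using set_lebesgue_integral_eq_integral(1) by simp
qed

lemma L2_on_add:
  assumes f: "L2_on L f" and g: "L2_on L g"
  shows "L2_on L (\<lambda>x. f x + g x)"
proof -
  have [measurable]: "f \<in> borel_measurable (lebesgue_on {-L..L})" "g \<in> borel_measurable (lebesgue_on {-L..L})"
    using f g by (auto simp: L2_on_iff)
  have "(\<lambda>x. (cmod (f x + g x))\<^sup>2) absolutely_integrable_on {-L..L}"
  proof (rule measurable_bounded_by_integrable_imp_absolutely_integrable)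
    show "(\<lambda>x. 2 * (cmod (f x))\<^sup>2 + 2 * (cmod (g x))\<^sup>2) integrable_on {-L..L}"
      using f g by (auto simp: L2_on_iff intro!: integrable_add)
    show "norm ((cmod (f x + g x))\<^sup>2) \<le> 2 * (cmod (f x))\<^sup>2 + 2 * (cmod (g x))\<^sup>2" if "x \<in> {-L..L}" for x
    proof -
      have "(cmod (f x + g x))\<^sup>2 \<le> (cmod (f x) + cmod (g x))\<^sup>2"
        by (intro power_mono norm_triangle_ineq) auto
      also have "\<dots> \<le> 2 * (cmod (f x))\<^sup>2 + 2 * (cmod (g x))\<^sup>2"
        using sum_squares_bound[of "cmod (f x)" "cmod (g x)"] by (simp add: power2_sum)
      finally show ?thesis by simp
    qed
  qed simp_all
  then show ?thesis
    unfolding L2_on_iff using set_lebesgue_integral_eq_integral(1) by simp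
qed

lemma L2_on_mult_integrable:
  assumes f: "L2_on L f" and g: "L2_on L g"
  shows "(\<lambda>x. f x * g x) absolutely_integrable_on {-L..L}"
proof (rule measurable_bounded_by_integrable_imp_absolutely_integrable)
  have [measurable]: "f \<in> borel_measurable (lebesgue_on {-L..L})" "g \<in> borel_measurable (lebesgue_on {-L..L})"
    using f g by (auto simp: L2_on_iff)
  show "(\<lambda>x. f x * g x) \<in> borel_measurable (lebesgue_on {-L..L})" by measurable
  show "(\<lambda>x. (cmod (f x))\<^sup>2 + (cmod (g x))\<^sup>2) integrable_on {-L..L}"
    using f g by (auto simp: L2_on_iff intro!: integrable_add)
  show "norm (f x * g x) \<le> (cmod (f x))\<^sup>2 + (cmod (g x))\<^sup>2" for x
  proof -
    have "0 \<le> cmod (f x) * cmod (g x)" by simp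
    with sum_squares_bound[of "cmod (f x)" "cmod (g x)"]
    show ?thesis unfolding norm_mult by linarith
  qed
qed auto

lemma L2_on_cnj: "L2_on L f \<Longrightarrow> L2_on L (\<lambda>x. cnj (f x))"
  unfolding L2_on_iff
  using measurable_compose[OF _ borel_measurable_continuous_onI[OF continuous_on_cnj[OF continuous_on_id]],
    of f "lebesgue_on {-L..L}"]
  by simp

lemma L2_on_integrable: "L2_on L f \<Longrightarrow> f absolutely_integrable_on {-L..L}"
  using L2_on_mult_integrable[OF L2_on_continuous[of L "\<lambda>_. 1"]] by simp

lemma L2_Cauchy_Schwarz:
  assumes f: "L2_on L f" and g: "L2_on L g"
  shows "integral {-L..L} (\<lambda>x. cmod (f x) * cmod (g x)) \<le> L2_norm L f * L2_norm L g"
proof -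
  define A B C where "A = integral {-L..L} (\<lambda>x. (cmod (f x))\<^sup>2)"
    and "B = integral {-L..L} (\<lambda>x. cmod (f x) * cmod (g x))"
    and "C = integral {-L..L} (\<lambda>x. (cmod (g x))\<^sup>2)"
  have iA: "(\<lambda>x. (cmod (f x))\<^sup>2) integrable_on {-L..L}" and iC: "(\<lambda>x. (cmod (g x))\<^sup>2) integrable_on {-L..L}"
    using f g by (auto simp: L2_on_iff)
  have iB: "(\<lambda>x. cmod (f x) * cmod (g x)) integrable_on {-L..L}"
    using L2_on_mult_integrable[OF f g] unfolding absolutely_integrable_on_def by (simp add: norm_mult)
  have AC: "0 \<le> A" "0 \<le> C" using iA iC by (auto simp: A_def C_def intro!: integral_nonneg)
  \<comment> \<open>The polynomial in \<open>t\<close> is the integral of the square of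
    \<open>t * cmod (f x) - cmod (g x)\<close>.\<close>
  have quad: "0 \<le> t\<^sup>2 * A - 2 * t * B + C" for t
  proof -
    have "((\<lambda>x. t\<^sup>2 * (cmod (f x))\<^sup>2 - 2 * t * (cmod (f x) * cmod (g x)) + (cmod (g x))\<^sup>2)
        has_integral t\<^sup>2 * A - 2 * t * B + C) {-L..L}"
      unfolding A_def B_def C_def
      by (intro has_integral_add has_integral_diff has_integral_mult_right integrable_integral iA iB iC)
    then show ?thesis
    proof (rule has_integral_nonneg)
      fix x
      have "0 \<le> (t * cmod (f x) - cmod (g x))\<^sup>2" by simp
      then show "0 \<le> t\<^sup>2 * (cmod (f x))\<^sup>2 - 2 * t * (cmod (f x) * cmod (g x)) + (cmod (g x))\<^sup>2"
        by (simp add: power2_diff power_mult_distrib algebra_simps)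
    qed
  qed
  have "B\<^sup>2 \<le> A * C"
  proof (cases "A = 0")
    case True
    have "B = 0"
    proof (rule ccontr)
      \<comment> \<open>For \<open>A = 0\<close> the polynomial is linear in \<open>t\<close>, and
        this choice of \<open>t\<close> gives it the value -1.\<close>
      assume "B \<noteq> 0"
      then have "2 * ((C + 1) / (2 * B)) * B = C + 1" by simp
      with quad[of "(C + 1) / (2 * B)"] True show False by simp
    qed
    then show ?thesis using AC by simp
  next
    case False
    \<comment> \<open>\<open>B / A\<close> is the minimiser of the quadratic.\<close>
    then have "(B / A)\<^sup>2 * A = B\<^sup>2 / A" "2 * (B / A) * B = 2 * (B\<^sup>2 / A)"
      by (simp_all add: power2_eq_square)
    with quad[of "B / A"] have "B\<^sup>2 / A \<le> C" by linarith
    then show ?thesis using False AC by (simp add: pos_divide_le_eq mult.commute)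
  qed
  then have "B \<le> sqrt (A * C)" by (rule real_le_rsqrt)
  then show ?thesis by (simp add: A_def B_def C_def L2_norm_def real_sqrt_mult)
qed

lemma H1_AC: "H1_with_deriv L v dv \<Longrightarrow> AC_on (-L) L v dv"
  unfolding H1_with_deriv_def AC_on_def by (elim conjE, intro conjI L2_on_integrable)

lemma H1_I:
  assumes v: "AC_on (-L) L v dv" and dv: "L2_on L dv"
  shows "H1_with_deriv L v dv"
  unfolding H1_with_deriv_def
  by (intro conjI ballI dv L2_on_continuous AC_on_continuous[OF v] AC_on_eq[OF v])

lemma negligible_if_integral_square_zero:
  assumes f: "L2_on L f" and 0: "integral {-L..L} (\<lambda>x. (cmod (f x))\<^sup>2) = 0"
  shows "negligible {x \<in> {-L..L}. f x \<noteq> 0}"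
proof -
  have i: "(\<lambda>x. (cmod (f x))\<^sup>2) absolutely_integrable_on {-L..L}"
    using f by (intro nonnegative_absolutely_integrable_1) (auto simp: L2_on_iff)
  then have i': "integrable lebesgue (\<lambda>x. indicator {-L..L} x *\<^sub>R (cmod (f x))\<^sup>2)"
    by (simp add: set_integrable_def)
  have "(LINT x|lebesgue. indicator {-L..L} x *\<^sub>R (cmod (f x))\<^sup>2) = 0"
    using set_lebesgue_integral_eq_integral(2)[OF i] 0 by (simp add: set_lebesgue_integral_def)
  then have "AE x in lebesgue. indicator {-L..L} x *\<^sub>R (cmod (f x))\<^sup>2 = 0"
    using integral_nonneg_eq_0_iff_AE[OF i'] by auto
  then have "AE x in lebesgue. x \<notin> {x \<in> {-L..L}. f x \<noteq> 0}"
    by eventually_elim (auto simp: indicator_def)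
  then show ?thesis
    by (simp add: negligible_iff_null_sets AE_iff_null_sets completion.AE_iff_null_sets conj_ac)
qed

text \<open>With \<open>H\<close> a primitive of \<open>h\<close>, the test function is the primitive of \<open>p + H\<close> minus its mean,
  so that the weak equation says that this difference has norm zero.\<close>

lemma du_Bois_Reymond:
  assumes L: "L > 0" and p: "L2_on L p" and h: "h absolutely_integrable_on {-L..L}"
    and weak: "\<And>v dv. H1_with_deriv L v dv \<Longrightarrow> v (-L) = 0 \<Longrightarrow> v L = 0 \<Longrightarrow>
      integral {-L..L} (\<lambda>x. p x * cnj (dv x) - h x * cnj (v x)) = 0"
  shows "\<exists>w. AC_on (-L) L w (\<lambda>x. - h x) \<and> negligible {x \<in> {-L..L}. w x \<noteq> p x}"
proof -
  define H where "H x = integral {-L..x} h" for x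
  have H: "AC_on (-L) L H h"
    using AC_on_indefinite_integral[OF h, of 0] by (simp add: H_def[abs_def])
  have pH: "L2_on L (\<lambda>x. p x + H x)"
    by (intro L2_on_add p L2_on_continuous AC_on_continuous[OF H])
  define \<kappa> where "\<kappa> = integral {-L..L} (\<lambda>x. p x + H x) / (2 * L)"
  define \<phi> where "\<phi> x = p x + H x + (- \<kappa>)" for x
  have \<phi>: "L2_on L \<phi>"
    unfolding \<phi>_def[abs_def] by (intro L2_on_add[OF pH] L2_on_continuous continuous_intros)
  define v where "v x = integral {-L..x} \<phi>" for x
  have v: "AC_on (-L) L v \<phi>"
    using AC_on_indefinite_integral[OF L2_on_integrable[OF \<phi>], of 0] by (simp add: v_def[abs_def])
  have i\<phi>: "(\<phi> has_integral 0) {-L..L}"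
  proof -
    have "((\<lambda>x. - \<kappa>) has_integral (2 * L) *\<^sub>R (- \<kappa>)) {-L..L}"
      using has_integral_const_real[of "- \<kappa>" "-L" L] L by simp
    from has_integral_add[OF integrable_integral this]
    have "(\<phi> has_integral integral {-L..L} (\<lambda>x. p x + H x) + (2 * L) *\<^sub>R (- \<kappa>)) {-L..L}"
      using L2_on_integrable[OF pH] unfolding \<phi>_def[abs_def] absolutely_integrable_on_def by blast
    then show ?thesis using L by (simp add: \<kappa>_def scaleR_conv_of_real)
  qed
  have v0: "v (-L) = 0" "v L = 0"
    using i\<phi> by (auto simp: v_def integral_unique)
  have vH: "H1_with_deriv L v \<phi>" using v \<phi> by (rule H1_I)
  have cv: "continuous_on {-L..L} v" by (rule AC_on_continuous[OF v])
  have parts: "integral {-L..L} (\<lambda>x. h x * cnj (v x) + H x * cnj (\<phi> x)) = 0"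
    using AC_on_mult_endpoint[OF H AC_on_cnj[OF v]] L v0 by simp
  have j1: "(\<lambda>x. p x * cnj (\<phi> x)) integrable_on {-L..L}"
    by (intro set_lebesgue_integral_eq_integral(1) L2_on_mult_integrable p L2_on_cnj \<phi>)
  have j2: "(\<lambda>x. cnj (v x) * h x) integrable_on {-L..L}"
    by (intro set_lebesgue_integral_eq_integral(1) continuous_mult_absolutely_integrable h continuous_intros cv)
  have j2': "(\<lambda>x. h x * cnj (v x)) integrable_on {-L..L}"
    using j2 by (simp add: mult.commute)
  have j3: "(\<lambda>x. H x * cnj (\<phi> x)) integrable_on {-L..L}"
    by (intro set_lebesgue_integral_eq_integral(1) L2_on_mult_integrable L2_on_cnj \<phi> L2_on_continuous
        AC_on_continuous[OF H])
  have j4: "((\<lambda>x. \<kappa> * cnj (\<phi> x)) has_integral \<kappa> * cnj 0) {-L..L}"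
    by (intro has_integral_mult_right) (use i\<phi> has_integral_cnj[of \<phi> 0] in \<open>simp add: o_def\<close>)
  \<comment> \<open>Three vanishing integrals are combined: the weak equation for \<open>v\<close>,
    integration by parts of \<open>H * cnj v\<close> (whose boundary terms are zero), and the mean
    of \<phi>. The terms with \<open>h\<close> cancel and
    \<open>(p + H - \<kappa>) * cnj \<phi>\<close> remains, which is the squared modulus of
    \<phi>.\<close>
  have "((\<lambda>x. (p x * cnj (\<phi> x) - h x * cnj (v x)) + (h x * cnj (v x) + H x * cnj (\<phi> x)) - \<kappa> * cnj (\<phi> x))
     has_integral 0 + 0 - \<kappa> * cnj 0) {-L..L}"
  proof (intro has_integral_add has_integral_diff j4)
    show "((\<lambda>x. p x * cnj (\<phi> x) - h x * cnj (v x)) has_integral 0) {-L..L}"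
      using weak[OF vH v0] integrable_integral[OF integrable_diff[OF j1 j2']] by simp
    show "((\<lambda>x. h x * cnj (v x) + H x * cnj (\<phi> x)) has_integral 0) {-L..L}"
      using parts integrable_integral[OF integrable_add[OF j2' j3]] by simp
  qed
  then have "((\<lambda>x. complex_of_real ((cmod (\<phi> x))\<^sup>2)) has_integral 0) {-L..L}"
  proof (rule has_integral_eq_rhs[OF has_integral_eq[rotated]])
    show "(p x * cnj (\<phi> x) - h x * cnj (v x)) + (h x * cnj (v x) + H x * cnj (\<phi> x)) - \<kappa> * cnj (\<phi> x)
        = complex_of_real ((cmod (\<phi> x))\<^sup>2)" for x
      unfolding complex_norm_square by (simp add: \<phi>_def algebra_simps)
  qed simp
  then have "integral {-L..L} (\<lambda>x. (cmod (\<phi> x))\<^sup>2) = 0"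
    by (intro integral_unique) (drule has_integral_Re, simp only: Re_complex_of_real zero_complex.simps)
  from negligible_if_integral_square_zero[OF \<phi> this]
  have "negligible {x \<in> {-L..L}. \<kappa> - H x \<noteq> p x}"
    by (rule negligible_subset) (auto simp: \<phi>_def algebra_simps)
  moreover have "AC_on (-L) L (\<lambda>x. \<kappa> - H x) (\<lambda>x. - h x)"
  proof -
    have "(\<lambda>x. - h x) absolutely_integrable_on {-L..L}"
      using continuous_mult_absolutely_integrable[OF continuous_on_const h, of "-1"] by simp
    from AC_on_indefinite_integral[OF this, of \<kappa>] show ?thesis
      by (simp add: H_def Henstock_Kurzweil_Integration.integral_neg)
  qed
  ultimately show ?thesis by blast
qed

section \<open>Piecewise smooth coefficients\<close>

lemma C1_piece_continuous: "C1_piece s t g G G' \<Longrightarrow> continuous_on {s..t} G"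
  unfolding C1_piece_def by (meson DERIV_continuous_on)

text \<open>Links the hypotheses on \<open>deriv\<close>, which concern \<open>g\<close>, with the
  derivative of its representative: both functions agree on an open neighbourhood of
  \<open>x\<close>.\<close>

lemma C1_piece_deriv:
  assumes g: "C1_piece s t g G G'" and x: "x \<in> {s<..<t}"
  shows "deriv g x = G' x"
proof -
  have "(G has_real_derivative G' x) (at x within {s..t})"
    using g x by (auto simp: C1_piece_def)
  then have "(G has_real_derivative G' x) (at x)"
    using x by (simp add: at_within_Icc_at)
  then have "(g has_real_derivative G' x) (at x)"
    using g x by (elim has_field_derivative_transform_within_open[where S = "{s<..<t}"])
      (auto simp: C1_piece_def)
  then show ?thesis by (rule DERIV_imp_deriv)
qed

text \<open>The one-sided limit ignores the value \<open>g t\<close>, so it is the end value of the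
  representative; this and its mirror image evaluate \<open>jump\<close>.\<close>

lemma C1_piece_Lim_left:
  assumes g: "C1_piece s t g G G'"
  shows "Lim (at_left t) g = G t"
proof (rule tendsto_Lim)
  have st: "s < t" using g by (simp add: C1_piece_def)
  have "(G \<longlongrightarrow> G t) (at_left t)"
    using C1_piece_continuous[OF g] st continuous_on_Icc_at_leftD by blast
  then show "(g \<longlongrightarrow> G t) (at_left t)"
    by (rule Lim_transform_eventually)
       (use g st in \<open>auto simp: C1_piece_def eventually_at_left intro!: exI[of _ s]\<close>)
qed simp

lemma C1_piece_Lim_right:
  assumes g: "C1_piece s t g G G'"
  shows "Lim (at_right s) g = G s"
proof (rule tendsto_Lim)
  have st: "s < t" using g by (simp add: C1_piece_def)
  have "(G \<longlongrightarrow> G s) (at_right s)"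
    using C1_piece_continuous[OF g] st continuous_on_Icc_at_rightD by blast
  then show "(g \<longlongrightarrow> G s) (at_right s)"
    by (rule Lim_transform_eventually)
       (use g st in \<open>auto simp: C1_piece_def eventually_at_right intro!: exI[of _ t]\<close>)
qed simp

text \<open>The open interval is dense in the closed one. This carries bounds known for
  \<open>g\<close> inside a piece to the end values of its representative.\<close>

lemma continuous_ge_on_Icc:
  fixes G :: "real \<Rightarrow> real"
  assumes "continuous_on {s..t} G" "s < t" "\<And>x. x \<in> {s<..<t} \<Longrightarrow> m \<le> G x" "x \<in> {s..t}"
  shows "m \<le> G x"
  using continuous_ge_on_closure[of "{s<..<t}" G x m] assms by simp

lemma C1_piece_divide:
  assumes q: "C1_piece s t q Q Q'" and a: "C1_piece s t a A A'" and nz: "\<And>x. x \<in> {s..t} \<Longrightarrow> A x \<noteq> 0"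
  shows "C1_piece s t (\<lambda>x. q x / a x) (\<lambda>x. Q x / A x) (\<lambda>x. (Q' x * A x - Q x * A' x) / (A x * A x))"
  unfolding C1_piece_def
proof (intro conjI ballI)
  show "continuous_on {s..t} (\<lambda>x. (Q' x * A x - Q x * A' x) / (A x * A x))"
    using q a nz C1_piece_continuous[OF q] C1_piece_continuous[OF a]
    by (intro continuous_intros) (auto simp: C1_piece_def)
  show "((\<lambda>x. Q x / A x) has_real_derivative (Q' x * A x - Q x * A' x) / (A x * A x)) (at x within {s..t})"
    if "x \<in> {s..t}" for x
    using q a nz that by (intro DERIV_divide) (auto simp: C1_piece_def)
qed (use q a in \<open>auto simp: C1_piece_def\<close>)

lemma C1_piece_power2:
  assumes a: "C1_piece s t a A A'"
  shows "C1_piece s t (\<lambda>x. (a x)\<^sup>2) (\<lambda>x. (A x)\<^sup>2) (\<lambda>x. 2 * A x * A' x)"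
  unfolding C1_piece_def
proof (intro conjI ballI)
  show "continuous_on {s..t} (\<lambda>x. 2 * A x * A' x)"
    using a C1_piece_continuous[OF a] by (intro continuous_intros) (auto simp: C1_piece_def)
  show "((\<lambda>x. (A x)\<^sup>2) has_real_derivative 2 * A x * A' x) (at x within {s..t})"
    if "x \<in> {s..t}" for x
    using a that by (auto simp: C1_piece_def intro!: derivative_eq_intros)
qed (use a in \<open>auto simp: C1_piece_def\<close>)

lemma partition_mono:
  assumes "is_partition L z N" "i \<le> j" "j \<le> N"
  shows "z i \<le> z j"
  using assms(2,3)
proof (induction j rule: dec_induct)
  case (step n)
  then have "z n < z (Suc n)" using assms(1) by (auto simp: is_partition_def)
  with step show ?case by auto
qed simp

lemma partition_subset:
  assumes "is_partition L z N" "i \<le> j" "j \<le> N"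
  shows "{z i..z j} \<subseteq> {-L..L}"
  using partition_mono[OF assms(1), of 0 i] partition_mono[OF assms(1), of j N] assms
  by (auto simp: is_partition_def)

text \<open>Appends one piece at a time, starting from the degenerate interval at \<open>-L\<close>;
  it serves properties that pass to the union of adjacent intervals.\<close>

lemma partition_induct [consumes 1, case_names base step]:
  assumes part: "is_partition L z N"
    and "P {-L..-L}"
    and "\<And>j. j \<in> {1..N} \<Longrightarrow> -L \<le> z (j - 1) \<Longrightarrow> z (j - 1) < z j \<Longrightarrow> P {-L..z (j - 1)} \<Longrightarrow> P {-L..z j}"
  shows "P {-L..L}"
proof -
  have "P {-L..z n}" if "n \<le> N" for n
    using that
  proof (induction n)
    case 0
    then show ?case using assms by (simp add: is_partition_def)
  next
    case (Suc n)
    then show ?case using assms(3)[of "Suc n"] part partition_mono[OF part, of 0 n]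
      by (auto simp: is_partition_def)
  qed
  then show ?thesis using part by (auto simp: is_partition_def)
qed

lemma pw_C1_piece:
  assumes "pw_C1 L z N g" "j \<in> {1..N}"
  obtains G G' where "C1_piece (z (j-1)) (z j) g G G'"
  using assms unfolding pw_C1_def by blast

text \<open>Integrability glues across adjacent intervals, and measurability is then read off from
  it in \<open>pw_C1_measurable\<close>.\<close>

lemma pw_C1_integrable:
  assumes part: "is_partition L z N" and g: "pw_C1 L z N g"
  shows "g integrable_on {-L..L}"
  using part
proof (induction rule: partition_induct)
  case base
  then show ?case using integrable_on_refl[of g "-L"] by simp
next
  case (step j)
  from pw_C1_piece[OF g step(1)] obtain G G' where G: "C1_piece (z (j-1)) (z j) g G G'" .
  have "g integrable_on {z (j-1)..z j}"
    by (rule integrable_spike_finite[of "{z (j-1), z j}", OF _ _ integrable_continuous_real[OF C1_piece_continuous[OF G]]])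
       (use G in \<open>auto simp: C1_piece_def\<close>)
  with step show ?case by (intro Henstock_Kurzweil_Integration.integrable_combine[of "-L" "z (j-1)" "z j"]) auto
qed

lemma pw_C1_bounded:
  assumes part: "is_partition L z N" and g: "pw_C1 L z N g"
  shows "bounded (g ` {-L..L})"
  using part
proof (induction rule: partition_induct)
  case (step j)
  from pw_C1_piece[OF g step(1)] obtain G G' where G: "C1_piece (z (j-1)) (z j) g G G'" .
  have "bounded (G ` {z (j-1)..z j})"
    by (intro compact_imp_bounded compact_continuous_image C1_piece_continuous[OF G]) simp
  \<comment> \<open>The point \<open>z j\<close> is listed separately because \<open>g\<close> and
    \<open>G\<close> may differ there.\<close>
  then have "bounded (g ` {-L..z (j-1)} \<union> G ` {z (j-1)..z j} \<union> {g (z j)})"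
    using step by simp
  then show ?case
  proof (rule bounded_subset)
    show "g ` {-L..z j} \<subseteq> g ` {-L..z (j-1)} \<union> G ` {z (j-1)..z j} \<union> {g (z j)}"
    proof
      fix y assume "y \<in> g ` {-L..z j}"
      then obtain x where x: "y = g x" "-L \<le> x" "x \<le> z j" by auto
      consider "x \<le> z (j-1)" | "x \<in> {z (j-1)<..<z j}" | "x = z j" using x by force
      then show "y \<in> g ` {-L..z (j-1)} \<union> G ` {z (j-1)..z j} \<union> {g (z j)}"
      proof cases
        case 2
        then have "y = G x" using G x by (auto simp: C1_piece_def)
        with 2 show ?thesis by auto
      qed (use x in auto)
    qed
  qed
qed simp

lemma pw_C1_mono_imp: "pw_C1_mono L z N g \<Longrightarrow> pw_C1 L z N g"
  unfolding pw_C1_def pw_C1_mono_def by blast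

lemma pw_C1_measurable:
  assumes "is_partition L z N" "pw_C1 L z N g"
  shows "g \<in> borel_measurable (lebesgue_on {-L..L})"
  by (rule integrable_imp_measurable[OF pw_C1_integrable[OF assms]])

text \<open>\<open>real_of_ereal\<close> sends infinite values to 0, so the essential supremum must
  first be shown finite: boundedness of \<open>q\<close> gives the upper bound, the absolute value
  the lower one.\<close>

lemma Linf_norm_bound:
  assumes L: "L > 0" and meas: "q \<in> borel_measurable (lebesgue_on {-L..L})" and bdd: "bounded (q ` {-L..L})"
  shows "0 \<le> Linf_norm L q" "negligible {x \<in> {-L<..<L}. Linf_norm L q < \<bar>q x\<bar>}"
proof -
  let ?M = "lebesgue_on {-L<..<L}"
  define E where "E = esssup ?M (\<lambda>x. ereal \<bar>q x\<bar>)"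
  have [measurable]: "q \<in> borel_measurable ?M"
    by (rule measurable_restrict_mono[OF meas]) auto
  obtain B where B: "\<And>x. x \<in> {-L..L} \<Longrightarrow> \<bar>q x\<bar> \<le> B"
    using bdd unfolding bounded_iff by (metis imageI real_norm_def)
  have "E \<le> ereal B"
    unfolding E_def by (rule esssup_I) (use B in \<open>auto intro!: AE_I2 simp: space_restrict_space\<close>)
  moreover have "0 \<le> E"
  proof -
    \<comment> \<open>A constant is its own essential supremum only on a space of nonzero measure;
      here \<open>L > 0\<close> enters.\<close>
    have "emeasure ?M (space ?M) \<noteq> 0"
      using L by (simp add: emeasure_restrict_space space_restrict_space)
    then have "0 = esssup ?M (\<lambda>_. 0)" by (simp add: esssup_const)
    also have "\<dots> \<le> E" unfolding E_def by (rule esssup_mono) auto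
    finally show ?thesis .
  qed
  ultimately have E: "E = ereal (Linf_norm L q)" "0 \<le> Linf_norm L q"
    unfolding Linf_norm_def E_def[symmetric] by (cases E; simp)+
  show "0 \<le> Linf_norm L q" by fact
  have "AE x in ?M. ereal \<bar>q x\<bar> \<le> E" unfolding E_def by (rule esssup_AE)
  then have "AE x in lebesgue. x \<in> {-L<..<L} \<longrightarrow> \<bar>q x\<bar> \<le> Linf_norm L q"
    by (subst (asm) AE_restrict_space_iff) (auto simp: E)
  then have "AE x in lebesgue. x \<notin> {x \<in> {-L<..<L}. Linf_norm L q < \<bar>q x\<bar>}"
    by eventually_elim auto
  then show "negligible {x \<in> {-L<..<L}. Linf_norm L q < \<bar>q x\<bar>}"
    by (simp add: negligible_iff_null_sets completion.AE_iff_null_sets conj_ac)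
qed

text \<open>Where the continuous representative exceeds \<open>Q\<close> inside the piece is an open
  null set, hence empty; density adds the end points. The end values are needed because
  \<open>q\<close> enters the boundary terms pointwise.\<close>

lemma C1_piece_le_of_ae:
  assumes g: "C1_piece s t g G G'" and neg: "negligible {x \<in> {s<..<t}. Q < \<bar>g x\<bar>}" and x: "x \<in> {s..t}"
  shows "\<bar>G x\<bar> \<le> Q"
proof -
  have st: "s < t" and gG: "\<And>x. x \<in> {s<..<t} \<Longrightarrow> G x = g x" using g by (auto simp: C1_piece_def)
  have cG: "continuous_on {s..t} G" by (rule C1_piece_continuous[OF g])
  have "open {x \<in> {s<..<t}. Q < \<bar>G x\<bar>}"
  proof -
    have "open ({s<..<t} \<inter> (\<lambda>x. \<bar>G x\<bar>) -` {Q<..})"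
      by (intro continuous_open_preimage continuous_intros continuous_on_subset[OF cG]) auto
    moreover have "{s<..<t} \<inter> (\<lambda>x. \<bar>G x\<bar>) -` {Q<..} = {x \<in> {s<..<t}. Q < \<bar>G x\<bar>}" by auto
    ultimately show ?thesis by simp
  qed
  moreover have "negligible {x \<in> {s<..<t}. Q < \<bar>G x\<bar>}"
    by (rule negligible_subset[OF neg]) (auto simp: gG)
  ultimately have "{x \<in> {s<..<t}. Q < \<bar>G x\<bar>} = {}" using open_not_negligible by blast
  then have "- Q \<le> - \<bar>G y\<bar>" if "y \<in> {s<..<t}" for y using that by force
  then have "- Q \<le> - \<bar>G x\<bar>"
    using continuous_ge_on_Icc[of s t "\<lambda>x. - \<bar>G x\<bar>" "- Q" x] x st cG
    by (simp add: continuous_on_minus continuous_on_rabs)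
  then show ?thesis by simp
qed

text \<open>Telescoping sum. \<Phi> is indexed by the piece, so an interior point \<open>z j\<close>
  carries a left and a right value, and the jump hypothesis exchanges the first for the
  second.\<close>

lemma partition_glue:
  assumes part: "is_partition L z N" and D: "D integrable_on {-L..L}"
    and loc: "\<And>j. j \<in> {1..N} \<Longrightarrow> integral {z (j-1)..z j} D \<le> \<Phi> j (z j) - \<Phi> j (z (j-1))"
    and jmp: "\<And>j. j \<in> {1..N-1} \<Longrightarrow> \<Phi> j (z j) \<le> (\<Phi> (Suc j) (z j) :: real)"
  shows "integral {-L..L} D \<le> \<Phi> N L - \<Phi> 1 (-L)"
proof -
  have z: "z 0 = -L" "z N = L" "N \<ge> 1" using part by (auto simp: is_partition_def)
  have "integral {z 0..z n} D \<le> \<Phi> n (z n) - \<Phi> 1 (z 0)" if "1 \<le> n" "n \<le> N" for n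
    using that
  proof (induction n rule: dec_induct)
    case base
    then show ?case using loc[of 1] z by simp
  next
    case (step n)
    have "integral {z 0..z (Suc n)} D = integral {z 0..z n} D + integral {z n..z (Suc n)} D"
      using step partition_mono[OF part, of 0 n] partition_mono[OF part, of n "Suc n"]
      by (intro Henstock_Kurzweil_Integration.integral_combine[symmetric]
          integrable_on_subinterval[OF D] partition_subset[OF part]) auto
    moreover have "\<Phi> n (z n) \<le> \<Phi> (Suc n) (z n)" using step by (intro jmp) auto
    ultimately show ?case using step loc[of "Suc n"] by auto
  qed
  from this[of N] show ?thesis using z by simp
qed

text \<open>\<open>P\<close> and \<open>R\<close> are the representatives of \<open>q / a\<close>
  and \<open>q / c^2\<close>. Since \<open>w = a u'\<close> almost everywhere,
  \<open>P * |w|^2\<close> stands for \<open>q a |u'|^2\<close>, written so that every factor can be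
  differentiated.\<close>

lemma piece_energy_flux:
  fixes u du w f :: "real \<Rightarrow> complex" and a c q :: "real \<Rightarrow> real" and \<omega> :: real
  defines "D \<equiv> \<lambda>x. a x * (cmod (du x))\<^sup>2 + (\<omega> / c x)\<^sup>2 * (cmod (u x))\<^sup>2 - 2 * q x * Re (f x * cnj (du x))"
  assumes u: "AC_on s t u du"
    and w: "AC_on s t w (\<lambda>x. - (of_real ((\<omega> / c x)\<^sup>2) * u x + f x))"
    and wa: "negligible {x \<in> {s..t}. w x \<noteq> of_real (a x) * du x}"
    and P: "C1_piece s t (\<lambda>x. q x / a x) P P'" and R: "C1_piece s t (\<lambda>x. q x / (c x)\<^sup>2) R R'"
    and pos: "\<And>x. x \<in> {s<..<t} \<Longrightarrow> a x > 0"
    and P': "\<And>x. x \<in> {s<..<t} \<Longrightarrow> 1 / a x \<le> P' x" and R': "\<And>x. x \<in> {s<..<t} \<Longrightarrow> 1 / (c x)\<^sup>2 \<le> R' x"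
    and D: "D integrable_on {s..t}"
  shows "integral {s..t} D \<le> (P t * (cmod (w t))\<^sup>2 + \<omega>\<^sup>2 * R t * (cmod (u t))\<^sup>2)
     - (P s * (cmod (w s))\<^sup>2 + \<omega>\<^sup>2 * R s * (cmod (u s))\<^sup>2)"
proof -
  have st: "s < t" using P by (simp add: C1_piece_def)
  have PAC: "AC_on s t (\<lambda>x. of_real (P x)) (\<lambda>x. of_real (P' x))"
    by (rule AC_on_of_real) (use P in \<open>auto simp: C1_piece_def\<close>)
  have RAC: "AC_on s t (\<lambda>x. of_real (\<omega>\<^sup>2 * R x)) (\<lambda>x. of_real (\<omega>\<^sup>2 * R' x))"
    by (rule AC_on_of_real)
       (use R in \<open>auto simp: C1_piece_def intro!: continuous_intros derivative_eq_intros\<close>)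
  define dw where "dw x = - (of_real ((\<omega> / c x)\<^sup>2) * u x + f x)" for x
  define \<Phi> where "\<Phi> x = of_real (P x) * (w x * cnj (w x)) + of_real (\<omega>\<^sup>2 * R x) * (u x * cnj (u x))" for x
  define d where "d x = (of_real (P' x) * (w x * cnj (w x)) + of_real (P x) * (dw x * cnj (w x) + w x * cnj (dw x)))
    + (of_real (\<omega>\<^sup>2 * R' x) * (u x * cnj (u x)) + of_real (\<omega>\<^sup>2 * R x) * (du x * cnj (u x) + u x * cnj (du x)))" for x
  have w': "AC_on s t w dw" using w unfolding dw_def[abs_def] .
  have \<Phi>: "AC_on s t \<Phi> d"
    unfolding \<Phi>_def[abs_def] d_def[abs_def]
    by (intro AC_on_add AC_on_mult PAC RAC AC_on_cnj u w')
  have Re\<Phi>: "Re (\<Phi> x) = P x * (cmod (w x))\<^sup>2 + \<omega>\<^sup>2 * R x * (cmod (u x))\<^sup>2" for x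
    unfolding \<Phi>_def complex_norm_square[symmetric] of_real_mult[symmetric] of_real_add[symmetric]
    by (rule Re_complex_of_real)
  have "(d has_integral \<Phi> t - \<Phi> s) {s..t}"
    using AC_on_diff[OF \<Phi>, of s t] AC_on_integrable[OF \<Phi>] st by (auto simp: has_integral_iff)
  from has_integral_Re[OF this] have d: "((\<lambda>x. Re (d x)) has_integral Re (\<Phi> t) - Re (\<Phi> s)) {s..t}" by simp
  \<comment> \<open>The end points are excluded too: there \<open>P\<close> and \<open>R\<close> are
    one-sided limits that need not match \<open>a\<close>, \<open>c\<close>, \<open>q\<close>, and
    the derivative bounds are given only inside. \<open>D'\<close> alters the integrand on this null
    set so that the comparison holds at every point.\<close>
  define NS where "NS = {x \<in> {s..t}. w x \<noteq> of_real (a x) * du x} \<union> {s, t}"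
  have NS: "negligible NS" using wa by (simp add: NS_def)
  define D' where "D' x = (if x \<in> NS then Re (d x) else D x)" for x
  have "(D' has_integral integral {s..t} D) {s..t}"
    by (rule has_integral_spike[OF NS _ integrable_integral[OF D]]) (auto simp: D'_def)
  then have "integral {s..t} D \<le> Re (\<Phi> t) - Re (\<Phi> s)"
    using d
  proof (rule has_integral_le)
    fix x assume x: "x \<in> {s..t}"
    show "D' x \<le> Re (d x)"
    proof (cases "x \<in> NS")
      case False
      then have xi: "x \<in> {s<..<t}" and wx: "w x = of_real (a x) * du x" using x by (auto simp: NS_def)
      have a: "a x > 0" by (rule pos[OF xi])
      have Px: "P x = q x / a x" and Rx: "R x = q x / (c x)\<^sup>2" using P R xi by (auto simp: C1_piece_def)
      define k where "k = (\<omega> / c x)\<^sup>2"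
      \<comment> \<open>These two equations make the cancellation work: the term from
        \<open>w'\<close> and the term from \<open>u'\<close> both carry the coefficient
        \<open>2 * q x * k\<close>, with opposite signs.\<close>
      have Pa: "P x * a x = q x" and Rk: "\<omega>\<^sup>2 * R x = q x * k"
        using a by (auto simp: Px Rx k_def power_divide)
      have "Re (d x) = P' x * (a x)\<^sup>2 * (cmod (du x))\<^sup>2 + \<omega>\<^sup>2 * R' x * (cmod (u x))\<^sup>2
         - 2 * (P x * a x) * (k * Re (u x * cnj (du x)) + Re (f x * cnj (du x)))
         + 2 * (\<omega>\<^sup>2 * R x) * Re (u x * cnj (du x))"
        unfolding d_def wx dw_def cmod_power2 k_def[symmetric] by (simp add: algebra_simps power2_eq_square)
      also have "\<dots> = (P' x * a x) * (a x * (cmod (du x))\<^sup>2) + R' x * (\<omega>\<^sup>2 * (cmod (u x))\<^sup>2) - 2 * q x * Re (f x * cnj (du x))"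
        unfolding Pa Rk by (simp only: power2_eq_square) (simp only: algebra_simps)
      also have "\<dots> \<ge> 1 * (a x * (cmod (du x))\<^sup>2) + 1 / (c x)\<^sup>2 * (\<omega>\<^sup>2 * (cmod (u x))\<^sup>2) - 2 * q x * Re (f x * cnj (du x))"
        using a P'[OF xi] R'[OF xi]
        by (intro add_mono diff_right_mono mult_right_mono) (auto simp: field_simps)
      finally show ?thesis using False by (simp add: D'_def D_def power_divide)
    qed (simp add: D'_def)
  qed
  then show ?thesis by (simp add: Re\<Phi>)
qed

section \<open>The stability estimate\<close>

text \<open>If \<open>M > A + B\<close>, then \<open>M^2 > A M + B M\<close>, and \<open>B M\<close>
  is at least \<open>B^2\<close>.\<close>

lemma le_add_of_square_le:
  fixes M A B :: real
  assumes "0 \<le> A" "0 \<le> B" "M\<^sup>2 \<le> A * M + B\<^sup>2"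
  shows "M \<le> A + B"
proof (rule ccontr)
  assume "\<not> M \<le> A + B"
  then have M: "A + B < M" "B \<le> M" using assms by auto
  then have "(A + B) * M < M * M" using assms by (intro mult_strict_right_mono) auto
  moreover have "B * B \<le> B * M" using M assms by (intro mult_left_mono) auto
  ultimately show False using assms(3) by (simp add: power2_eq_square algebra_simps)
qed

text \<open>Here \<open>M\<close> is the energy norm, \<open>U\<close> and \<open>dU\<close> are the
  L2 norms of \<open>u\<close> and \<open>u'\<close>, \<open>F\<close> and \<open>G\<close> those of
  the data, \<open>S\<close> is the boundary energy and \<open>T\<close> the boundary term of the
  imaginary part. Eliminating \<open>S\<close>, \<open>T\<close>, \<open>U\<close>,
  \<open>dU\<close> leaves a quadratic inequality in \<open>M\<close>.\<close>

lemma stability_arithmetic: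
  fixes M Q F G S T U dU \<omega> amin cmin cmax :: real
  assumes pos: "amin > 0" "cmin > 0" "cmin \<le> cmax" "\<omega> > 0" "0 \<le> Q" "0 \<le> F" "0 \<le> G"
    and dU: "dU \<le> M / sqrt amin" and U: "U \<le> cmax / \<omega> * M"
    and M: "M\<^sup>2 \<le> 2 * Q * (F * dU) + Q * S"
    and S: "S \<le> 2 / amin * G\<^sup>2 + 3 * (\<omega> / (cmin * sqrt amin)) * T"
    and T: "T \<le> 2 * (F * U) + cmax / (\<omega> * sqrt amin) * G\<^sup>2"
  shows "M \<le> (2 / sqrt amin * (1 + 3 * cmax / cmin)) * Q * F
      + (2 / sqrt amin * sqrt (3/2 * cmax / cmin + 1)) * sqrt Q * G"
proof (rule le_add_of_square_le)
  define s where "s = sqrt amin"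
  define r where "r = cmax / cmin"
  have s: "s > 0" "s\<^sup>2 = amin" using pos by (auto simp: s_def)
  have r: "r \<ge> 0" using pos by (auto simp: r_def)
  have T': "T \<le> 2 * (F * (cmax / \<omega> * M)) + cmax / (\<omega> * s) * G\<^sup>2"
    using T mult_left_mono[OF U \<open>0 \<le> F\<close>] by (simp add: s_def)
  have "3 * (\<omega> / (cmin * s)) * T \<le> 3 * (\<omega> / (cmin * s)) * (2 * (F * (cmax / \<omega> * M)) + cmax / (\<omega> * s) * G\<^sup>2)"
    by (rule mult_left_mono[OF T']) (use pos s in auto)
  \<comment> \<open>The frequency cancels here, so the final constants depend only on the
    coefficient bounds.\<close>
  also have "\<dots> = 6 * r / s * (F * M) + 3 * r / s\<^sup>2 * G\<^sup>2"
    using pos s(1) by (simp add: r_def field_simps power2_eq_square)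
  finally have "S \<le> 2 / s\<^sup>2 * G\<^sup>2 + (6 * r / s * (F * M) + 3 * r / s\<^sup>2 * G\<^sup>2)"
    using S s(2) by (simp add: s_def)
  then have QS: "Q * S \<le> Q * (2 / s\<^sup>2 * G\<^sup>2 + (6 * r / s * (F * M) + 3 * r / s\<^sup>2 * G\<^sup>2))"
    by (rule mult_left_mono) fact
  have "2 * Q * (F * dU) \<le> 2 * Q * (F * (M / s))"
    using pos dU by (intro mult_left_mono) (auto simp: s_def)
  with M QS have "M\<^sup>2 \<le> 2 * Q * (F * (M / s)) + Q * (2 / s\<^sup>2 * G\<^sup>2 + (6 * r / s * (F * M) + 3 * r / s\<^sup>2 * G\<^sup>2))"
    by linarith
  also have "\<dots> = (2 / s * (1 + 3 * r)) * Q * F * M + (3 * r + 2) / s\<^sup>2 * Q * G\<^sup>2"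
    using s(1) by (simp add: field_simps power2_eq_square)
  \<comment> \<open>The stated second constant has square \<open>(6 * r + 4) / s^2\<close>, twice
    the coefficient derived so far.\<close>
  also have "(3 * r + 2) / s\<^sup>2 * Q * G\<^sup>2 \<le> (6 * r + 4) / s\<^sup>2 * Q * G\<^sup>2"
    using r pos s by (intro mult_right_mono divide_right_mono) auto
  also have "(6 * r + 4) / s\<^sup>2 * Q * G\<^sup>2 = (2 / s * sqrt (3/2 * r + 1) * sqrt Q * G)\<^sup>2"
  proof -
    have "(2 / s * sqrt (3/2 * r + 1) * sqrt Q * G)\<^sup>2 = 4 / s\<^sup>2 * (3/2 * r + 1) * Q * G\<^sup>2"
      using r pos by (simp add: power_mult_distrib power_divide)
    moreover have "4 / s\<^sup>2 * (3/2 * r + 1) = (6 * r + 4) / s\<^sup>2"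
      by (simp add: algebra_simps add_divide_distrib)
    ultimately show ?thesis by simp
  qed
  finally show "M\<^sup>2 \<le> (2 / sqrt amin * (1 + 3 * cmax / cmin)) * Q * F * M
      + ((2 / sqrt amin * sqrt (3/2 * cmax / cmin + 1)) * sqrt Q * G)\<^sup>2"
    by (simp add: s_def r_def)
qed (use pos in \<open>auto intro!: mult_nonneg_nonneg add_nonneg_nonneg divide_nonneg_nonneg\<close>)

text \<open>Used with \<open>p = a u'\<close> and \<open>m = (\<omega>/c)^2 u\<close>. Test
  functions vanishing at both ends are admissible for every choice of the Dirichlet set, so one flux
  serves all three cases. The last conclusion is Green's formula for arbitrary \<open>v\<close>;
  comparing it with the weak equation exposes the boundary condition.\<close>

lemma flux_exists:
  assumes L: "L > 0" and p: "L2_on L p" and m: "L2_on L m" and f: "L2_on L f"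
    and weak: "\<And>v dv. H1_with_deriv L v dv \<Longrightarrow> v (-L) = 0 \<Longrightarrow> v L = 0 \<Longrightarrow>
      integral {-L..L} (\<lambda>x. p x * cnj (dv x) - m x * cnj (v x)) = integral {-L..L} (\<lambda>x. f x * cnj (v x))"
  obtains w where "AC_on (-L) L w (\<lambda>x. - (m x + f x))" "negligible {x \<in> {-L..L}. w x \<noteq> p x}"
    "\<And>v dv. H1_with_deriv L v dv \<Longrightarrow>
      integral {-L..L} (\<lambda>x. p x * cnj (dv x) - m x * cnj (v x)) - integral {-L..L} (\<lambda>x. f x * cnj (v x))
      = w L * cnj (v L) - w (-L) * cnj (v (-L))"
proof -
  have split: "integral {-L..L} (\<lambda>x. p x * cnj (dv x) - m x * cnj (v x)) - integral {-L..L} (\<lambda>x. f x * cnj (v x))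
      = integral {-L..L} (\<lambda>x. p x * cnj (dv x) - (m x + f x) * cnj (v x))" if v: "H1_with_deriv L v dv" for v dv
  proof -
    have vv: "L2_on L v" "L2_on L dv" using v by (auto simp only: H1_with_deriv_def)
    have i: "(\<lambda>x. p x * cnj (dv x)) integrable_on {-L..L}" "(\<lambda>x. m x * cnj (v x)) integrable_on {-L..L}"
        "(\<lambda>x. f x * cnj (v x)) integrable_on {-L..L}"
      by (intro set_lebesgue_integral_eq_integral(1) L2_on_mult_integrable p m f L2_on_cnj vv)+
    show ?thesis
      unfolding Henstock_Kurzweil_Integration.integral_diff[OF integrable_diff[OF i(1,2)] i(3), symmetric]
      by (simp add: algebra_simps)
  qed
  have mf: "L2_on L (\<lambda>x. m x + f x)" by (rule L2_on_add[OF m f])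
  obtain w where w: "AC_on (-L) L w (\<lambda>x. - (m x + f x))" and wp: "negligible {x \<in> {-L..L}. w x \<noteq> p x}"
    using du_Bois_Reymond[OF L p L2_on_integrable[OF mf]] weak split by (metis (no_types, lifting) diff_self)
  have "integral {-L..L} (\<lambda>x. p x * cnj (dv x) - m x * cnj (v x)) - integral {-L..L} (\<lambda>x. f x * cnj (v x))
      = w L * cnj (v L) - w (-L) * cnj (v (-L))" if v: "H1_with_deriv L v dv" for v dv
  proof -
    have "integral {-L..L} (\<lambda>x. p x * cnj (dv x) - (m x + f x) * cnj (v x))
        = integral {-L..L} (\<lambda>x. - (m x + f x) * cnj (v x) + w x * cnj (dv x))"
      by (rule integral_spike[OF wp]) (auto simp: algebra_simps)
    also have "\<dots> = w L * cnj (v L) - w (-L) * cnj (v (-L))"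
      using L by (intro AC_on_mult_endpoint[OF w AC_on_cnj[OF H1_AC[OF v]]]) auto
    finally show ?thesis using split[OF v] by simp
  qed
  with w wp show ?thesis by (rule that)
qed

lemma H1_linear:
  assumes "y \<in> {-L, L}" "L > 0"
  shows "H1_with_deriv L (\<lambda>x. of_real ((x + y) / (2 * y))) (\<lambda>x. of_real (1 / (2 * y)))"
proof (rule H1_I)
  show "AC_on (-L) L (\<lambda>x. of_real ((x + y) / (2 * y))) (\<lambda>x. of_real (1 / (2 * y)))"
    by (rule AC_on_of_real) (use assms in \<open>auto intro!: derivative_eq_intros\<close>)
  show "L2_on L (\<lambda>x. of_real (1 / (2 * y)))" by (rule L2_on_continuous) (rule continuous_on_const)
qed

lemma bounded_mult_integrable:
  fixes b g :: "real \<Rightarrow> real"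
  assumes "b \<in> borel_measurable (lebesgue_on {-L..L})" "bounded (b ` {-L..L})" "g absolutely_integrable_on {-L..L}"
  shows "(\<lambda>x. b x * g x) integrable_on {-L..L}"
  by (intro set_lebesgue_integral_eq_integral(1) absolutely_integrable_bounded_measurable_product_real assms) simp

lemma L2_on_square_absolutely_integrable:
  "L2_on L f \<Longrightarrow> (\<lambda>x. (cmod (f x))\<^sup>2) absolutely_integrable_on {-L..L}"
  by (intro nonnegative_absolutely_integrable_1) (auto simp: L2_on_iff)

lemma L2_norm_power2: "L2_on L f \<Longrightarrow> (L2_norm L f)\<^sup>2 = integral {-L..L} (\<lambda>x. (cmod (f x))\<^sup>2)"
  unfolding L2_norm_def by (intro real_sqrt_pow2 integral_nonneg) (auto simp: L2_on_iff)

lemma L2_norm_nonneg: "L2_on L f \<Longrightarrow> 0 \<le> L2_norm L f"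
  unfolding L2_norm_def by (intro real_sqrt_ge_zero integral_nonneg) (auto simp: L2_on_iff)

lemma L2_pairing_bound:
  assumes f: "L2_on L f" and g: "L2_on L g"
  shows "cmod (integral {-L..L} (\<lambda>x. f x * cnj (g x))) \<le> L2_norm L f * L2_norm L g"
proof -
  have i: "(\<lambda>x. f x * cnj (g x)) absolutely_integrable_on {-L..L}"
    by (intro L2_on_mult_integrable f L2_on_cnj g)
  then have "cmod (integral {-L..L} (\<lambda>x. f x * cnj (g x))) \<le> integral {-L..L} (\<lambda>x. cmod (f x) * cmod (g x))"
    unfolding absolutely_integrable_on_def
    by (intro integral_norm_bound_integral) (auto simp: norm_mult)
  also have "\<dots> \<le> L2_norm L f * L2_norm L g" by (rule L2_Cauchy_Schwarz[OF f g])
  finally show ?thesis .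
qed

text \<open>By \<open>(x + y)^2 <= 2 x^2 + 2 y^2\<close> and
  \<open>k^2 = a \<omega>^2 / c^2\<close>, the flux contributes two copies of
  \<open>\<omega>^2 |u|^2 / c^2\<close>; with the one already present this makes the factor
  3.\<close>

lemma impedance_boundary_bound:
  fixes w g u :: complex and a c \<omega> k :: real
  assumes bc: "w = g + \<i> * of_real k * u" and k: "k = \<omega> * sqrt a / c" and pos: "a > 0" "c > 0"
  shows "(cmod w)\<^sup>2 / a + \<omega>\<^sup>2 * (cmod u)\<^sup>2 / c\<^sup>2 \<le> 2 * (cmod g)\<^sup>2 / a + 3 * (\<omega>\<^sup>2 * (cmod u)\<^sup>2 / c\<^sup>2)"
proof -
  have "(cmod w)\<^sup>2 \<le> (cmod g + \<bar>k\<bar> * cmod u)\<^sup>2"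
    unfolding bc using norm_triangle_ineq[of g "\<i> * of_real k * u"]
    by (intro power_mono) (auto simp: norm_mult)
  also have "\<dots> \<le> 2 * (cmod g)\<^sup>2 + 2 * (\<bar>k\<bar> * cmod u)\<^sup>2"
    using sum_squares_bound[of "cmod g" "\<bar>k\<bar> * cmod u"] by (simp add: power2_sum)
  also have "(\<bar>k\<bar> * cmod u)\<^sup>2 = a * (\<omega>\<^sup>2 * (cmod u)\<^sup>2 / c\<^sup>2)"
    using pos by (simp add: k power_mult_distrib power_divide)
  finally have "(cmod w)\<^sup>2 / a \<le> (2 * (cmod g)\<^sup>2 + 2 * (a * (\<omega>\<^sup>2 * (cmod u)\<^sup>2 / c\<^sup>2))) / a"
    using pos by (intro divide_right_mono) auto
  also have "\<dots> = 2 * (cmod g)\<^sup>2 / a + 2 * (\<omega>\<^sup>2 * (cmod u)\<^sup>2 / c\<^sup>2)"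
    using pos by (simp add: add_divide_distrib)
  finally show ?thesis by simp
qed

theorem theorem5p4:
  fixes L \<omega> \<omega>0 amin amax cmin cmax :: real
    and \<Gamma>D \<Gamma>N :: "real set"
    and a c q :: "real \<Rightarrow> real"
    and z :: "nat \<Rightarrow> real" and N :: nat
    and f u du gN :: "real \<Rightarrow> complex"
  assumes L_pos: "L > 0"
    and bc: "(\<Gamma>D, \<Gamma>N) \<in> {({}, {-L, L}), ({L}, {-L}), ({-L}, {L})}"
    and omega: "\<omega>0 > 0" "\<omega> \<ge> \<omega>0"
    and amin_pos: "amin > 0" and cmin_pos: "cmin > 0"
    and a_bnd: "\<forall>x\<in>{-L..L}. amin \<le> a x \<and> a x \<le> amax"
    and c_bnd: "\<forall>x\<in>{-L..L}. cmin \<le> c x \<and> c x \<le> cmax"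
    and part: "is_partition L z N"
    and a_pw: "pw_C1_mono L z N a"
    and c_pw: "pw_C1_mono L z N c"
    and f_L2: "L2_on L f"
    and u_H: "H1_with_deriv L u du" "\<forall>x\<in>\<Gamma>D. u x = 0"
    and u_sol: "\<forall>v dv. H1_with_deriv L v dv \<and> (\<forall>x\<in>\<Gamma>D. v x = 0) \<longrightarrow>
        integral {-L..L} (\<lambda>x. complex_of_real (a x) * du x * cnj (dv x)
                              - complex_of_real ((\<omega> / c x)\<^sup>2) * u x * cnj (v x))
        - \<i> * (\<Sum>x\<in>\<Gamma>N. complex_of_real (\<omega> * sqrt (a x) / c x) * u x * cnj (v x))
        = integral {-L..L} (\<lambda>x. f x * cnj (v x)) + (\<Sum>x\<in>\<Gamma>N. gN x * cnj (v x))"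
    and q_pw: "pw_C1 L z N q"
    and q_D: "\<forall>x\<in>\<Gamma>D. q x = 0"
    and q_a: "\<forall>j\<in>{1..N}. \<forall>x\<in>{z (j-1)<..<z j}. deriv (\<lambda>y. q y / a y) x \<ge> 1 / a x"
    and q_c: "\<forall>j\<in>{1..N}. \<forall>x\<in>{z (j-1)<..<z j}. deriv (\<lambda>y. q y / (c y)\<^sup>2) x \<ge> 1 / (c x)\<^sup>2"
    and jump_a: "\<forall>j\<in>{1..N-1}. jump (\<lambda>y. q y / a y) (z j) \<le> 0"
    and jump_c: "\<forall>j\<in>{1..N-1}. jump (\<lambda>y. q y / (c y)\<^sup>2) (z j) \<le> 0"
  shows "sqrt (integral {-L..L} (\<lambda>x. a x * (cmod (du x))\<^sup>2)
               + integral {-L..L} (\<lambda>x. (\<omega> / c x)\<^sup>2 * (cmod (u x))\<^sup>2))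
    \<le> (2 / sqrt amin * (1 + 3 * cmax / cmin)) * Linf_norm L q * L2_norm L f
      + (2 / sqrt amin * sqrt (3/2 * cmax / cmin + 1)) * sqrt (Linf_norm L q)
          * sqrt (\<Sum>x\<in>\<Gamma>N. (cmod (gN x))\<^sup>2)"
proof -
  define K where "K = integral {-L..L} (\<lambda>x. a x * (cmod (du x))\<^sup>2)
     + integral {-L..L} (\<lambda>x. (\<omega> / c x)\<^sup>2 * (cmod (u x))\<^sup>2)"
  define Q where "Q = Linf_norm L q"
  define G where "G = sqrt (\<Sum>x\<in>\<Gamma>N. (cmod (gN x))\<^sup>2)"
  define k where "k x = \<omega> * sqrt (a x) / c x" for x
  define T where "T = (\<Sum>x\<in>\<Gamma>N. k x * (cmod (u x))\<^sup>2)"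
  define \<Gamma> where "\<Gamma> = {-L, L}"
  \<comment> \<open>The case distinction on the boundary sets happens here; afterwards only these
    set relations are used.\<close>
  have \<Gamma>: "finite \<Gamma>N" "\<Gamma>N \<subseteq> \<Gamma>" "\<Gamma>D \<inter> \<Gamma>N = {}" "\<Gamma> - \<Gamma>N = \<Gamma>D" "\<Gamma> \<subseteq> {-L..L}"
    using bc L_pos by (auto simp: \<Gamma>_def)
  have \<omega>: "\<omega> > 0" using omega by simp
  have a: "a x > 0" "amin \<le> a x" "a x \<le> amax" and c: "c x > 0" "cmin \<le> c x" "c x \<le> cmax"
    if "x \<in> {-L..L}" for x
    using that a_bnd c_bnd amin_pos cmin_pos by force+
  have cmax: "cmin \<le> cmax" using c[of 0] L_pos by simp
  have z: "z 0 = -L" "z N = L" "N \<ge> 1"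
    using part by (auto simp: is_partition_def)
  have piece_sub: "{z (j-1)..z j} \<subseteq> {-L..L}" if "j \<in> {1..N}" for j
    using that by (intro partition_subset[OF part]) auto
  have uL2: "L2_on L u" and duL2: "L2_on L du" using u_H(1) by (auto simp only: H1_with_deriv_def)
  have uAC: "AC_on (-L) L u du" by (rule H1_AC[OF u_H(1)])

  have am: "a \<in> borel_measurable (lebesgue_on {-L..L})" and cm: "c \<in> borel_measurable (lebesgue_on {-L..L})"
    and qm: "q \<in> borel_measurable (lebesgue_on {-L..L})"
    using pw_C1_measurable[OF part] pw_C1_mono_imp a_pw c_pw q_pw by blast+
  define m where "m x = (\<omega> / c x)\<^sup>2" for x
  have mm: "m \<in> borel_measurable (lebesgue_on {-L..L})" unfolding m_def[abs_def] using cm by measurable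
  have mb: "0 \<le> m x" "m x \<le> (\<omega> / cmin)\<^sup>2" "(\<omega> / cmax)\<^sup>2 \<le> m x" if "x \<in> {-L..L}" for x
    unfolding m_def using c[OF that] cmin_pos \<omega> by (auto intro!: power_mono divide_left_mono)
  have "\<bar>a x\<bar> \<le> amax" "\<bar>m x\<bar> \<le> (\<omega> / cmin)\<^sup>2" if "x \<in> {-L..L}" for x
    using a[OF that] mb[OF that] by auto
  then have bdd: "bounded (a ` {-L..L})" "bounded (m ` {-L..L})" "bounded (q ` {-L..L})"
    using pw_C1_bounded[OF part q_pw] unfolding bounded_iff real_norm_def by blast+

  \<comment> \<open>The flux and the impedance condition\<close>
  have pL2: "L2_on L (\<lambda>x. of_real (a x) * du x)"
    by (rule L2_on_bounded_mult[OF _ _ duL2, where B = amax]) (use am a in \<open>auto simp: abs_of_pos\<close>)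
  have mL2: "L2_on L (\<lambda>x. of_real (m x) * u x)"
    by (rule L2_on_bounded_mult[OF _ _ uL2, where B = "(\<omega> / cmin)\<^sup>2"]) (use mm mb in auto)
  have sol: "integral {-L..L} (\<lambda>x. of_real (a x) * du x * cnj (dv x) - of_real (m x) * u x * cnj (v x))
      - integral {-L..L} (\<lambda>x. f x * cnj (v x))
      = \<i> * (\<Sum>x\<in>\<Gamma>N. of_real (k x) * u x * cnj (v x)) + (\<Sum>x\<in>\<Gamma>N. gN x * cnj (v x))"
    if "H1_with_deriv L v dv" "\<forall>x\<in>\<Gamma>D. v x = 0" for v dv
    using u_sol[rule_format, of v dv] that unfolding k_def m_def by (simp add: algebra_simps)
  have sol0: "integral {-L..L} (\<lambda>x. of_real (a x) * du x * cnj (dv x) - of_real (m x) * u x * cnj (v x))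
      = integral {-L..L} (\<lambda>x. f x * cnj (v x))"
    if "H1_with_deriv L v dv" "v (-L) = 0" "v L = 0" for v dv
  proof -
    have v0: "v x = 0" if "x \<in> \<Gamma>" for x using that \<open>v (-L) = 0\<close> \<open>v L = 0\<close> by (auto simp: \<Gamma>_def)
    have "(\<Sum>x\<in>\<Gamma>N. of_real (k x) * u x * cnj (v x)) = 0" "(\<Sum>x\<in>\<Gamma>N. gN x * cnj (v x)) = 0"
      using \<Gamma> v0 by (auto intro!: sum.neutral)
    with sol[OF that(1)] v0 \<Gamma> show ?thesis by auto
  qed
  obtain w where wAC: "AC_on (-L) L w (\<lambda>x. - (of_real (m x) * u x + f x))"
    and wp: "negligible {x \<in> {-L..L}. w x \<noteq> of_real (a x) * du x}"
    and green: "\<And>v dv. H1_with_deriv L v dv \<Longrightarrow>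
      integral {-L..L} (\<lambda>x. of_real (a x) * du x * cnj (dv x) - of_real (m x) * u x * cnj (v x))
      - integral {-L..L} (\<lambda>x. f x * cnj (v x))
      = w L * cnj (v L) - w (-L) * cnj (v (-L))"
    using flux_exists[OF L_pos pL2 mL2 f_L2 sol0] by blast

  \<comment> \<open>At the two ends of the interval \<Phi> equals \<open>q * E\<close>.\<close>
  define E where "E x = (cmod (w x))\<^sup>2 / a x + \<omega>\<^sup>2 * (cmod (u x))\<^sup>2 / (c x)\<^sup>2" for x
  have impedance: "E y \<le> 2 * (cmod (gN y))\<^sup>2 / a y + 3 * (\<omega>\<^sup>2 * (cmod (u y))\<^sup>2 / (c y)\<^sup>2)"
    if y: "y \<in> \<Gamma>N" for y
  proof -
    have yL: "y = L \<or> y = -L" "y \<noteq> 0" "y \<in> {-L..L}"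
      using subsetD[OF \<Gamma>(2) y] L_pos by (auto simp: \<Gamma>_def)
    \<comment> \<open>The affine test function with value 1 at \<open>y\<close> and 0 at the other end point.\<close>
    define v :: "real \<Rightarrow> complex" where "v x = of_real ((x + y) / (2 * y))" for x
    have vH: "H1_with_deriv L v (\<lambda>x. of_real (1 / (2 * y)))"
      unfolding v_def[abs_def] by (rule H1_linear) (use yL(1) L_pos in blast)+
    have v1: "v y = 1" "v (- y) = 0" using yL(2) by (simp_all add: v_def)
    have v0: "v x = 0" if "x \<in> \<Gamma>" "x \<noteq> y" for x
    proof -
      have "x = - y" using that yL(1) by (auto simp: \<Gamma>_def)
      then show ?thesis using v1(2) by simp
    qed
    have vD: "\<forall>x\<in>\<Gamma>D. v x = 0" using v0 y \<Gamma>(3,4) by (metis DiffD1 disjoint_iff)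
    have s1: "(\<Sum>x\<in>\<Gamma>N. h x * cnj (v x)) = h y" for h
    proof -
      have "(\<Sum>x\<in>\<Gamma>N. h x * cnj (v x)) = (\<Sum>x\<in>{y}. h x * cnj (v x))"
      proof (rule sum.mono_neutral_right)
        show "\<forall>x\<in>\<Gamma>N - {y}. h x * cnj (v x) = 0"
          using \<Gamma>(2) v0 by (metis DiffE complex_cnj_zero mult_zero_right singletonI subsetD)
      qed (use \<Gamma>(1) y in simp_all)
      then show ?thesis using v1(1) by simp
    qed
    have eq: "w L * cnj (v L) - w (-L) * cnj (v (-L)) = \<i> * (of_real (k y) * u y) + gN y"
      using green[OF vH] sol[OF vH vD] unfolding s1[of "\<lambda>x. of_real (k x) * u x"] s1[of gN] by simp
    have "cmod (w y) = cmod (gN y + \<i> * of_real (k y) * u y)"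
      using yL(1)
    proof
      assume "y = L"
      then have "w y = gN y + \<i> * of_real (k y) * u y" using eq v1 by (simp add: algebra_simps)
      then show ?thesis by simp
    next
      \<comment> \<open>At the left end the outward flux is \<open>- w\<close>; taking moduli lets
        both ends share one bound.\<close>
      assume "y = -L"
      then have "- w y = \<i> * (of_real (k y) * u y) + gN y" using eq v1 by simp
      then have "- w y = gN y + \<i> * of_real (k y) * u y" by (simp only: mult.assoc add.commute)
      then show ?thesis using norm_minus_cancel[of "w y"] by simp
    qed
    then show ?thesis
      using impedance_boundary_bound[OF refl k_def[of y], of "gN y" "u y"] a(1)[OF yL(3)] c(1)[OF yL(3)]
      by (simp add: E_def)
  qed

  \<comment> \<open>The bound on q and one-sided representatives of the coefficients\<close>
  have Q0: "0 \<le> Q" and Qneg: "negligible {x \<in> {-L<..<L}. Q < \<bar>q x\<bar>}"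
    unfolding Q_def using Linf_norm_bound[OF L_pos qm bdd(3)] by auto

  have "\<exists>A A' C C' q1 q1'. C1_piece (z (j-1)) (z j) a A A' \<and> C1_piece (z (j-1)) (z j) c C C' \<and>
      C1_piece (z (j-1)) (z j) q q1 q1' \<and>
      (j = 1 \<longrightarrow> A (-L) = a (-L) \<and> C (-L) = c (-L) \<and> q1 (-L) = q (-L)) \<and>
      (j = N \<longrightarrow> A L = a L \<and> C L = c L \<and> q1 L = q L)" if "j \<in> {1..N}" for j
  proof -
    from a_pw that obtain A A' where "C1_piece (z (j-1)) (z j) a A A'"
      "j = 1 \<longrightarrow> A (-L) = a (-L)" "j = N \<longrightarrow> A L = a L" unfolding pw_C1_mono_def by blast
    moreover from c_pw that obtain C C' where "C1_piece (z (j-1)) (z j) c C C'"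
      "j = 1 \<longrightarrow> C (-L) = c (-L)" "j = N \<longrightarrow> C L = c L" unfolding pw_C1_mono_def by blast
    moreover from q_pw that obtain q1 q1' where "C1_piece (z (j-1)) (z j) q q1 q1'"
      "j = 1 \<longrightarrow> q1 (-L) = q (-L)" "j = N \<longrightarrow> q1 L = q L" unfolding pw_C1_def by blast
    ultimately show ?thesis by blast
  qed
  then obtain A A' C C' q1 q1' where
    piece: "\<And>j. j \<in> {1..N} \<Longrightarrow> C1_piece (z (j-1)) (z j) a (A j) (A' j)"
      "\<And>j. j \<in> {1..N} \<Longrightarrow> C1_piece (z (j-1)) (z j) c (C j) (C' j)"
      "\<And>j. j \<in> {1..N} \<Longrightarrow> C1_piece (z (j-1)) (z j) q (q1 j) (q1' j)"
    and left: "A 1 (-L) = a (-L)" "C 1 (-L) = c (-L)" "q1 1 (-L) = q (-L)"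
    and right: "A N L = a L" "C N L = c L" "q1 N L = q L"
    using z(3) by (metis atLeastAtMost_iff order_refl)
  \<comment> \<open>Positivity must hold on the closed piece for the quotients \<open>P\<close> and
    \<open>R\<close> to be C1 up to its ends; there it follows from continuity and the uniform lower
    bounds.\<close>
  have A0: "A j x > 0" and C0: "C j x > 0" if "j \<in> {1..N}" "x \<in> {z (j-1)..z j}" for j x
  proof -
    have lower: "mn \<le> G x" if "C1_piece (z (j-1)) (z j) g G G'" "\<forall>x\<in>{-L..L}. mn \<le> g x" for g G G' mn
    proof (rule continuous_ge_on_Icc[OF C1_piece_continuous[OF that(1)]])
      show "mn \<le> G y" if "y \<in> {z (j-1)<..<z j}" for y
        using \<open>C1_piece _ _ g G G'\<close> \<open>\<forall>x\<in>{-L..L}. mn \<le> g x\<close> that piece_sub[OF \<open>j \<in> {1..N}\<close>]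
        unfolding C1_piece_def by (metis atLeastAtMost_iff greaterThanLessThan_iff less_imp_le subset_iff)
    qed (use that \<open>x \<in> {z (j-1)..z j}\<close> in \<open>auto simp: C1_piece_def\<close>)
    show "A j x > 0" using lower[OF piece(1)] that a amin_pos by (meson less_le_trans)
    show "C j x > 0" using lower[OF piece(2)] that c cmin_pos by (meson less_le_trans)
  qed
  define P where "P j x = q1 j x / A j x" for j x
  define R where "R j x = q1 j x / (C j x)\<^sup>2" for j x
  have "\<exists>P'. C1_piece (z (j-1)) (z j) (\<lambda>x. q x / a x) (P j) P'" if "j \<in> {1..N}" for j
    unfolding P_def[abs_def] using C1_piece_divide[OF piece(3)[OF that] piece(1)[OF that]] A0[OF that] by force
  then obtain P' where P': "\<And>j. j \<in> {1..N} \<Longrightarrow> C1_piece (z (j-1)) (z j) (\<lambda>x. q x / a x) (P j) (P' j)"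
    by metis
  have "\<exists>R'. C1_piece (z (j-1)) (z j) (\<lambda>x. q x / (c x)\<^sup>2) (R j) R'" if "j \<in> {1..N}" for j
    unfolding R_def[abs_def]
    using C1_piece_divide[OF piece(3)[OF that] C1_piece_power2[OF piece(2)[OF that]]] C0[OF that] by force
  then obtain R' where R': "\<And>j. j \<in> {1..N} \<Longrightarrow> C1_piece (z (j-1)) (z j) (\<lambda>x. q x / (c x)\<^sup>2) (R j) (R' j)"
    by metis

  \<comment> \<open>Summation of the energy inequality over the pieces\<close>
  define \<Phi> where "\<Phi> j x = P j x * (cmod (w x))\<^sup>2 + \<omega>\<^sup>2 * R j x * (cmod (u x))\<^sup>2" for j x
  define D where "D x = a x * (cmod (du x))\<^sup>2 + (\<omega> / c x)\<^sup>2 * (cmod (u x))\<^sup>2 - 2 * q x * Re (f x * cnj (du x))" for x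
  have Re_ai: "(\<lambda>x. Re (f x * cnj (du x))) absolutely_integrable_on {-L..L}"
    using absolutely_integrable_linear[OF L2_on_mult_integrable[OF f_L2 L2_on_cnj[OF duL2]] bounded_linear_Re]
    by (simp only: o_def)
  have i1: "(\<lambda>x. a x * (cmod (du x))\<^sup>2) integrable_on {-L..L}"
    by (intro bounded_mult_integrable am bdd L2_on_square_absolutely_integrable duL2)
  have i2: "(\<lambda>x. m x * (cmod (u x))\<^sup>2) integrable_on {-L..L}"
    by (intro bounded_mult_integrable mm bdd L2_on_square_absolutely_integrable uL2)
  have i3: "(\<lambda>x. q x * Re (f x * cnj (du x))) integrable_on {-L..L}"
    by (intro bounded_mult_integrable qm bdd Re_ai)
  define I3 where "I3 = integral {-L..L} (\<lambda>x. q x * Re (f x * cnj (du x)))"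
  have D_int: "(D has_integral K - 2 * I3) {-L..L}"
  proof -
    have "((\<lambda>x. a x * (cmod (du x))\<^sup>2 + m x * (cmod (u x))\<^sup>2 - 2 * (q x * Re (f x * cnj (du x)))) has_integral K - 2 * I3) {-L..L}"
      unfolding K_def I3_def m_def[symmetric]
      by (intro has_integral_add has_integral_diff has_integral_mult_right integrable_integral i1 i2 i3)
    then show ?thesis unfolding D_def[abs_def] m_def by (simp only: mult.assoc)
  qed
  then have Di: "D integrable_on {-L..L}" by blast
  have flux: "integral {-L..L} D \<le> \<Phi> N L - \<Phi> 1 (-L)"
  proof (rule partition_glue[OF part Di])
    fix j assume j: "j \<in> {1..N}"
    have sub: "-L \<le> z (j-1)" "z j \<le> L"
      using partition_mono[OF part, of 0 "j-1"] partition_mono[OF part, of j N] j z by auto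
    show "integral {z (j-1)..z j} D \<le> \<Phi> j (z j) - \<Phi> j (z (j-1))"
      unfolding \<Phi>_def D_def[abs_def]
    proof (rule piece_energy_flux)
      show "AC_on (z (j-1)) (z j) u du" by (rule AC_on_subinterval[OF uAC sub])
      show "AC_on (z (j-1)) (z j) w (\<lambda>x. - (of_real ((\<omega> / c x)\<^sup>2) * u x + f x))"
        using AC_on_subinterval[OF wAC sub] unfolding m_def .
      show "negligible {x \<in> {z (j-1)..z j}. w x \<noteq> of_real (a x) * du x}"
        by (rule negligible_subset[OF wp]) (use sub in auto)
      show "a x > 0" if "x \<in> {z (j-1)<..<z j}" for x using that sub a by auto
      show "1 / a x \<le> P' j x" if "x \<in> {z (j-1)<..<z j}" for x
        using q_a[rule_format, OF j that] C1_piece_deriv[OF P'[OF j] that] by simp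
      show "1 / (c x)\<^sup>2 \<le> R' j x" if "x \<in> {z (j-1)<..<z j}" for x
        using q_c[rule_format, OF j that] C1_piece_deriv[OF R'[OF j] that] by simp
      show "(\<lambda>x. a x * (cmod (du x))\<^sup>2 + (\<omega> / c x)\<^sup>2 * (cmod (u x))\<^sup>2 - 2 * q x * Re (f x * cnj (du x)))
          integrable_on {z (j-1)..z j}"
        using integrable_on_subinterval[OF Di piece_sub[OF j]] unfolding D_def[abs_def] .
    qed (rule P'[OF j] R'[OF j])+
  next
    fix j assume j: "j \<in> {1..N-1}"
    then have j1: "j \<in> {1..N}" and j2: "Suc j \<in> {1..N}" by auto
    \<comment> \<open>The left limit at \<open>z j\<close> belongs to piece \<open>j\<close>, the
      right limit to piece \<open>Suc j\<close>, whose left end appears as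
      \<open>z (Suc j - 1)\<close>.\<close>
    have jp: "jump g (z j) = G (z j) - H (z j)"
      if "C1_piece (z (j-1)) (z j) g G G'" "C1_piece (z (Suc j - 1)) (z (Suc j)) g H H'" for g G G' H H'
      using C1_piece_Lim_left[OF that(1)] C1_piece_Lim_right[OF that(2)] by (simp add: jump_def)
    have "P j (z j) \<le> P (Suc j) (z j)" "R j (z j) \<le> R (Suc j) (z j)"
      using jump_a[rule_format, OF j] jump_c[rule_format, OF j] jp[OF P'[OF j1] P'[OF j2]] jp[OF R'[OF j1] R'[OF j2]]
      by auto
    then show "\<Phi> j (z j) \<le> \<Phi> (Suc j) (z j)"
      unfolding \<Phi>_def by (intro add_mono mult_right_mono mult_left_mono) auto
  qed

  \<comment> \<open>Boundary values of the energy flux\<close>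
  have qb: "\<bar>q y\<bar> \<le> Q" if "y \<in> \<Gamma>" for y
  proof -
    have bound: "\<bar>q1 j x\<bar> \<le> Q" if "j \<in> {1..N}" "x \<in> {z (j-1)..z j}" for j x
      by (rule C1_piece_le_of_ae[OF piece(3)[OF that(1)] negligible_subset[OF Qneg] that(2)])
         (use piece_sub[OF that(1)] partition_mono[OF part, of 0 "j-1"] partition_mono[OF part, of j N] that z in auto)
    show ?thesis
      \<comment> \<open>At \<open>-L\<close> and \<open>L\<close> the representatives of the first
        and last piece take the values of \<open>q\<close> itself, so the essential bound holds
        pointwise there.\<close>
      using bound[of 1 "-L"] bound[of N L] z left right partition_mono[OF part, of 0 1]
        partition_mono[OF part, of "N-1" N] \<open>y \<in> \<Gamma>\<close> by (auto simp: \<Gamma>_def)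
  qed
  have E0: "0 \<le> E x" if "x \<in> \<Gamma>" for x
    using a(1)[of x] that \<Gamma>(5) unfolding E_def
    by (intro add_nonneg_nonneg divide_nonneg_nonneg mult_nonneg_nonneg) (auto simp: less_imp_le)
  have "\<Phi> N L = q L * E L" "\<Phi> 1 (-L) = q (-L) * E (-L)"
    unfolding \<Phi>_def P_def R_def E_def left right by (simp_all add: algebra_simps)
  \<comment> \<open>The signs of \<open>q\<close> at the two ends are not prescribed, hence the
    absolute values.\<close>
  then have "\<Phi> N L - \<Phi> 1 (-L) \<le> \<bar>q L\<bar> * E L + \<bar>q (-L)\<bar> * E (-L)"
    using mult_right_mono[OF abs_ge_self[of "q L"] E0[of L]] mult_right_mono[OF abs_ge_minus_self[of "q (-L)"] E0[of "-L"]]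
    by (simp add: \<Gamma>_def)
  also have "\<dots> = (\<Sum>x\<in>\<Gamma>. \<bar>q x\<bar> * E x)" using L_pos by (simp add: \<Gamma>_def)
  also have "\<dots> = (\<Sum>x\<in>\<Gamma>N. \<bar>q x\<bar> * E x)"
  proof (rule sum.mono_neutral_right)
    show "\<forall>x\<in>\<Gamma> - \<Gamma>N. \<bar>q x\<bar> * E x = 0" unfolding \<Gamma>(4) using q_D by simp
  qed (use \<Gamma>(2) in \<open>simp_all add: \<Gamma>_def\<close>)
  also have "\<dots> \<le> (\<Sum>x\<in>\<Gamma>N. Q * E x)"
    using qb E0 \<Gamma>(2) by (intro sum_mono mult_right_mono) auto
  finally have bdry: "\<Phi> N L - \<Phi> 1 (-L) \<le> Q * sum E \<Gamma>N" by (simp add: sum_distrib_left)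

  \<comment> \<open>The source term\<close>
  have I3: "I3 \<le> Q * (L2_norm L f * L2_norm L du)"
  proof -
    define h where "h x = cmod (f x) * cmod (du x)" for x
    have hi: "h integrable_on {-L..L}"
      using L2_on_mult_integrable[OF f_L2 duL2] unfolding absolutely_integrable_on_def h_def norm_mult by blast
    \<comment> \<open>On \<open>[-L, L]\<close> the bound by \<open>Q\<close> is available only off
      this null set, so the integrand is set to 0 on it.\<close>
    define NS where "NS = {x \<in> {-L<..<L}. Q < \<bar>q x\<bar>} \<union> {-L, L}"
    define qf where "qf x = (if x \<in> NS then 0 else q x * Re (f x * cnj (du x)))" for x
    have "(qf has_integral I3) {-L..L}"
      unfolding I3_def
      by (rule has_integral_spike[OF _ _ integrable_integral[OF i3], of NS]) (use Qneg in \<open>auto simp: NS_def qf_def\<close>)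
    moreover have "((\<lambda>x. Q * h x) has_integral Q * integral {-L..L} h) {-L..L}"
      by (intro has_integral_mult_right integrable_integral hi)
    ultimately have "I3 \<le> Q * integral {-L..L} h"
    proof (rule has_integral_le)
      fix x assume x: "x \<in> {-L..L}"
      have h0: "0 \<le> h x" by (simp add: h_def)
      show "qf x \<le> Q * h x"
      proof (cases "x \<in> NS")
        case False
        then have "\<bar>q x\<bar> \<le> Q" using x by (force simp: NS_def)
        moreover have "\<bar>Re (f x * cnj (du x))\<bar> \<le> h x"
          using abs_Re_le_cmod[of "f x * cnj (du x)"] by (simp add: h_def norm_mult)
        ultimately have "\<bar>q x * Re (f x * cnj (du x))\<bar> \<le> Q * h x"
          unfolding abs_mult using h0 Q0 by (intro mult_mono) auto
        then show ?thesis using False unfolding qf_def by (simp only: if_False)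
      qed (use h0 Q0 in \<open>simp add: qf_def\<close>)
    qed
    also have "\<dots> \<le> Q * (L2_norm L f * L2_norm L du)"
      unfolding h_def[abs_def] by (intro mult_left_mono L2_Cauchy_Schwarz f_L2 duL2 Q0)
    finally show ?thesis .
  qed
  have K: "K \<le> 2 * Q * (L2_norm L f * L2_norm L du) + Q * sum E \<Gamma>N"
    using flux bdry I3 integral_unique[OF D_int] by simp

  \<comment> \<open>Boundary energy in terms of the data and the impedance term\<close>
  have k0: "0 < k x" "1 / k x \<le> cmax / (\<omega> * sqrt amin)" "\<omega>\<^sup>2 / (c x)\<^sup>2 \<le> \<omega> / (cmin * sqrt amin) * k x"
    if "x \<in> {-L..L}" for x
  proof -
    note b = a[OF that] c[OF that]
    show "0 < k x" using b \<omega> by (simp add: k_def)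
    have "1 / k x = c x / (\<omega> * sqrt (a x))" by (simp add: k_def)
    also have "\<dots> \<le> cmax / (\<omega> * sqrt amin)"
      using b \<omega> amin_pos by (intro frac_le mult_left_mono) auto
    finally show "1 / k x \<le> cmax / (\<omega> * sqrt amin)" .
    have "\<omega>\<^sup>2 / (c x)\<^sup>2 = \<omega> / (c x * sqrt (a x)) * k x"
      using b by (simp add: k_def power2_eq_square)
    also have "\<dots> \<le> \<omega> / (cmin * sqrt amin) * k x"
      using b \<omega> amin_pos cmin_pos \<open>0 < k x\<close> by (intro mult_right_mono divide_left_mono mult_mono mult_pos_pos) auto
    finally show "\<omega>\<^sup>2 / (c x)\<^sup>2 \<le> \<omega> / (cmin * sqrt amin) * k x" .
  qed
  have GN: "\<Gamma>N \<subseteq> {-L..L}" using \<Gamma>(2,5) by (rule subset_trans)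
  have G2: "G\<^sup>2 = (\<Sum>x\<in>\<Gamma>N. (cmod (gN x))\<^sup>2)" unfolding G_def by (intro real_sqrt_pow2 sum_nonneg) auto

  have S: "sum E \<Gamma>N \<le> 2 / amin * G\<^sup>2 + 3 * (\<omega> / (cmin * sqrt amin)) * T"
  proof -
    have "sum E \<Gamma>N \<le> (\<Sum>x\<in>\<Gamma>N. 2 / amin * (cmod (gN x))\<^sup>2 + 3 * (\<omega> / (cmin * sqrt amin)) * (k x * (cmod (u x))\<^sup>2))"
    proof (rule sum_mono)
      fix x assume x: "x \<in> \<Gamma>N"
      then have xL: "x \<in> {-L..L}" using GN by auto
      have "2 * (cmod (gN x))\<^sup>2 / a x \<le> 2 * (cmod (gN x))\<^sup>2 / amin"
        using a[OF xL] amin_pos by (intro divide_left_mono) auto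
      moreover have "\<omega>\<^sup>2 / (c x)\<^sup>2 * (cmod (u x))\<^sup>2 \<le> \<omega> / (cmin * sqrt amin) * k x * (cmod (u x))\<^sup>2"
        using k0(3)[OF xL] by (rule mult_right_mono) simp
      ultimately show "E x \<le> 2 / amin * (cmod (gN x))\<^sup>2 + 3 * (\<omega> / (cmin * sqrt amin)) * (k x * (cmod (u x))\<^sup>2)"
        using impedance[OF x] by (simp add: mult.assoc)
    qed
    then show ?thesis by (simp add: G2 T_def sum.distrib sum_distrib_left)
  qed

  \<comment> \<open>The imaginary part of the weak equation tested with u\<close>
  have T: "T \<le> 2 * (L2_norm L f * L2_norm L u) + cmax / (\<omega> * sqrt amin) * G\<^sup>2"
  proof -
    have eq: "integral {-L..L} (\<lambda>x. of_real (a x) * du x * cnj (du x) - of_real (m x) * u x * cnj (u x))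
        = of_real (integral {-L..L} (\<lambda>x. a x * (cmod (du x))\<^sup>2 - m x * (cmod (u x))\<^sup>2))"
    proof -
      have "of_real (a x) * du x * cnj (du x) - of_real (m x) * u x * cnj (u x)
          = complex_of_real (a x * (cmod (du x))\<^sup>2 - m x * (cmod (u x))\<^sup>2)" for x
        unfolding of_real_diff of_real_mult complex_norm_square by (simp only: mult.assoc)
      then show ?thesis
        by (simp only:) (intro integral_unique has_integral_of_real integrable_integral integrable_diff i1 i2)
    qed
    have kT: "(\<Sum>x\<in>\<Gamma>N. of_real (k x) * u x * cnj (u x)) = complex_of_real T"
      unfolding T_def of_real_sum of_real_mult complex_norm_square by (simp only: mult.assoc)
    define J where "J = integral {-L..L} (\<lambda>x. f x * cnj (u x))"
    \<comment> \<open>The volume integral on the left is real by \<open>eq\<close>, so only the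
      impedance term contributes to the imaginary part of that side.\<close>
    have "Im (\<i> * complex_of_real T) = - Im J - Im (\<Sum>x\<in>\<Gamma>N. gN x * cnj (u x))"
      using arg_cong[OF sol[OF u_H], of Im] unfolding eq kT J_def[symmetric] by simp
    then have "T = - Im J - Im (\<Sum>x\<in>\<Gamma>N. gN x * cnj (u x))" by simp
    also have "\<dots> \<le> cmod J + cmod (\<Sum>x\<in>\<Gamma>N. gN x * cnj (u x))"
      using abs_Im_le_cmod[of J] abs_Im_le_cmod[of "\<Sum>x\<in>\<Gamma>N. gN x * cnj (u x)"] by linarith
    also have "\<dots> \<le> L2_norm L f * L2_norm L u + (\<Sum>x\<in>\<Gamma>N. 1 / 2 * (k x * (cmod (u x))\<^sup>2) + 1 / 2 * (cmax / (\<omega> * sqrt amin) * (cmod (gN x))\<^sup>2))"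
    proof (rule add_mono)
      show "cmod J \<le> L2_norm L f * L2_norm L u" unfolding J_def by (rule L2_pairing_bound[OF f_L2 uL2])
      have "cmod (\<Sum>x\<in>\<Gamma>N. gN x * cnj (u x)) \<le> (\<Sum>x\<in>\<Gamma>N. cmod (gN x * cnj (u x)))" by (rule norm_sum)
      also have "\<dots> \<le> (\<Sum>x\<in>\<Gamma>N. 1 / 2 * (k x * (cmod (u x))\<^sup>2) + 1 / 2 * (cmax / (\<omega> * sqrt amin) * (cmod (gN x))\<^sup>2))"
      proof (rule sum_mono)
        fix x assume "x \<in> \<Gamma>N"
        then have xL: "x \<in> {-L..L}" using GN by auto
        have kx: "0 < k x" by (rule k0(1)[OF xL])
        \<comment> \<open>Young's inequality weighted by \<open>sqrt (k x)\<close> produces exactly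
          half of the summand of \<open>T\<close>. Absorbing \<open>T / 2\<close> on the left
          doubles the source term, whence its factor 2.\<close>
        have "2 * (sqrt (k x) * cmod (u x)) * (cmod (gN x) / sqrt (k x)) \<le> (sqrt (k x) * cmod (u x))\<^sup>2 + (cmod (gN x) / sqrt (k x))\<^sup>2"
          by (rule sum_squares_bound)
        then have "2 * cmod (gN x * cnj (u x)) \<le> k x * (cmod (u x))\<^sup>2 + 1 / k x * (cmod (gN x))\<^sup>2"
          using kx by (simp add: power_mult_distrib power_divide norm_mult mult.commute)
        also have "1 / k x * (cmod (gN x))\<^sup>2 \<le> cmax / (\<omega> * sqrt amin) * (cmod (gN x))\<^sup>2"
          by (rule mult_right_mono[OF k0(2)[OF xL]]) simp
        finally show "cmod (gN x * cnj (u x)) \<le> 1 / 2 * (k x * (cmod (u x))\<^sup>2) + 1 / 2 * (cmax / (\<omega> * sqrt amin) * (cmod (gN x))\<^sup>2)"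
          by simp
      qed
      finally show "cmod (\<Sum>x\<in>\<Gamma>N. gN x * cnj (u x)) \<le> (\<Sum>x\<in>\<Gamma>N. 1 / 2 * (k x * (cmod (u x))\<^sup>2) + 1 / 2 * (cmax / (\<omega> * sqrt amin) * (cmod (gN x))\<^sup>2))" .
    qed
    also have "\<dots> = L2_norm L f * L2_norm L u + 1 / 2 * T + 1 / 2 * (cmax / (\<omega> * sqrt amin) * G\<^sup>2)"
      unfolding sum.distrib sum_distrib_left[symmetric] T_def[symmetric] G2[symmetric] by simp
    finally show ?thesis by linarith
  qed

  \<comment> \<open>Energy control of the L2 norms and conclusion\<close>
  have I1: "0 \<le> integral {-L..L} (\<lambda>x. a x * (cmod (du x))\<^sup>2)"
    by (rule integral_nonneg[OF i1]) (use a(1) in \<open>simp add: less_imp_le\<close>)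
  have I2: "0 \<le> integral {-L..L} (\<lambda>x. m x * (cmod (u x))\<^sup>2)"
    by (rule integral_nonneg[OF i2]) (use mb in auto)
  have K0: "0 \<le> K" using I1 I2 by (simp add: K_def m_def)
  \<comment> \<open>Each of the two norms is bounded by dropping the other, nonnegative part of
    \<open>K\<close>.\<close>
  have "amin * (L2_norm L du)\<^sup>2 \<le> K"
  proof -
    have "integral {-L..L} (\<lambda>x. amin * (cmod (du x))\<^sup>2) \<le> integral {-L..L} (\<lambda>x. a x * (cmod (du x))\<^sup>2)"
      using duL2 a by (intro integral_le i1 integrable_on_mult_right) (auto simp: L2_on_iff intro!: mult_right_mono)
    then show ?thesis using I2 by (simp add: L2_norm_power2[OF duL2] K_def m_def)
  qed
  then have "sqrt (amin * (L2_norm L du)\<^sup>2) \<le> sqrt K" by simp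
  then have dU: "L2_norm L du \<le> sqrt K / sqrt amin"
    using amin_pos L2_norm_nonneg[OF duL2] by (simp add: real_sqrt_mult pos_le_divide_eq mult.commute)
  have "(\<omega> / cmax)\<^sup>2 * (L2_norm L u)\<^sup>2 \<le> K"
  proof -
    have "integral {-L..L} (\<lambda>x. (\<omega> / cmax)\<^sup>2 * (cmod (u x))\<^sup>2) \<le> integral {-L..L} (\<lambda>x. m x * (cmod (u x))\<^sup>2)"
      using uL2 mb by (intro integral_le i2 integrable_on_mult_right) (auto simp: L2_on_iff intro!: mult_right_mono)
    then show ?thesis using I1 by (simp add: L2_norm_power2[OF uL2] K_def m_def)
  qed
  then have "(\<omega> / cmax * L2_norm L u)\<^sup>2 \<le> K" by (simp only: power_mult_distrib)
  then have "\<omega> / cmax * L2_norm L u \<le> sqrt K" by (rule real_le_rsqrt)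
  then have U: "L2_norm L u \<le> cmax / \<omega> * sqrt K"
    using \<omega> cmax cmin_pos by (simp add: field_simps)

  have "sqrt K \<le> (2 / sqrt amin * (1 + 3 * cmax / cmin)) * Q * L2_norm L f
      + (2 / sqrt amin * sqrt (3/2 * cmax / cmin + 1)) * sqrt Q * G"
  proof (rule stability_arithmetic[OF amin_pos cmin_pos cmax \<omega> Q0 L2_norm_nonneg[OF f_L2] _ dU U _ S T])
    show "0 \<le> G" unfolding G_def by (intro real_sqrt_ge_zero sum_nonneg) simp
    show "(sqrt K)\<^sup>2 \<le> 2 * Q * (L2_norm L f * L2_norm L du) + Q * sum E \<Gamma>N" using K K0 by simp
  qed
  then show ?thesis unfolding K_def Q_def G_def .
qed

end
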